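(* Let $T>0$, $N\ge 1$, and let $L\colon[-T,T]\times\mathbb R^N\times\mathbb R^N\to\mathbb R$ be given by $L(t,x,v)=G(v)+V(t,x)+\langle f(t),x\rangle$. Assume: (A1) $G\colon\mathbb R^N\to[0,\infty)$ is a continuously differentiable G-function satisfying the $\Delta_2$ and $\nabla_2$ conditions (not necessarily globally); (A2) $V(t,x)=K(t,x)-W(t,x)$ with $K,W\in C^1([-T,T]\times\mathbb R^N,\mathbb R)$; (A3) $a\in L^1([-T,T],\mathbb R)$, $b>1$ and $\rho_0>0$ are such that $V(t,x)\ge b\,G(x)-a(t)$ for $|x|\le\rho_0$, $t\in[-T,T]$; (A4) there exist $b_1>0$ and $p>1$ with $|\cdot|^p\prec G$ such that $\liminf_{|x|\to\infty}\frac{K(t,x)}{|x|^p}\ge b_1$ uniformly in $t\in[-T,T]$ and $\liminf_{|x|\to\infty}\frac{W(t,x)}{\max\{K(t,x),G(x)\}}>3$ uniformly in $t\in[-T,T]$; (A5) there exist $\nu\in\mathbb R$, $\mu>q_G^\infty+\nu$ and $\kappa\in L^1([-T,T],[0,\infty))$ such that $\langle V_x(t,x),x\rangle\le(q_G^\infty+\nu)K(t,x)-\mu W(t,x)+\kappa(t)$ for all $(t,x)\in[-T,T]\times\mathbb R^N$; (A6) $\int_{-T}^TV(t,0)\,dt=0$; (A7) $f\in L^{G^*}([-T,T],\mathbb R^N)$. Let $C$ be an embedding constant for $W^1_TL^G\hookrightarrow L^\infty$ and put $\rho:=\rho_0/C$. Assume moreover that $\rho\ge2$ and $$R_{G^*}(f)+\int_{-T}^Ta(t)\,dt<\min\{1,b-1\}\,(\rho/2).$$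 Then the problem $$\frac{d}{dt}L_v(t,u(t),\dot u(t))=L_x(t,u(t),\dot u(t))\ \text{ for a.e. }t\in[-T,T],\qquad u(-T)=u(T),$$ that is, $\frac{d}{dt}\nabla G(\dot u(t))=V_x(t,u(t))+f(t)$ for a.e. $t$ with $u(-T)=u(T)$, has a (periodic) solution $u\in W^1_TL^G$.
   Context: $|\cdot|$ and $\langle\cdot,\cdot\rangle$ are the Euclidean norm and inner product on $\mathbb R^N$. A G-function is a function $G\colon\mathbb R^N\to[0,\infty)$ that is convex, even, with $G(0)=0$ and $G(x)/|x|\to\infty$ as $|x|\to\infty$. $\Delta_2$: there exist $K_1>2$, $M_1\ge0$ with $G(2x)\le K_1G(x)$ for all $|x|\ge M_1$. $\nabla_2$: there exist $K_2>1$, $M_2\ge0$ with $G(x)\le\frac1{2K_2}G(K_2x)$ for all $|x|\ge M_2$. (They hold globally if $M_1=0$, resp. $M_2=0$.) $G_1\prec G_2$ means: there exist $M\ge0$, $k>0$ with $G_1(x)\le G_2(kx)$ for all $|x|\ge M$. Fenchel conjugate: $G^*(y)=\sup_{x\in\mathbb R^N}\{\langle x,y\rangle-G(x)\}$. Modular: $R_G(u)=\int_{-T}^TG(u(t))\,dt$ (and likewise $R_{G^*}$). Index: $q_G^\infty=\limsup_{|x|\to\infty}\frac{\langle x,\nabla G(x)\rangle}{G(x)}$. Orlicz space: $L^G=\{u\colon[-T,T]\to\mathbb R^N\text{ measurable}:\int_{-T}^TG(u)\,dt<\infty\}$ with the Luxemburg norm $\|u\|_{L^G}=\inf\{\lambda>0:\int_{-T}^TG(u/\lambda)\,dt\le1\}$;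 $L^{G^*}$ is defined in the same way with $G^*$. Orlicz–Sobolev space: $W^1_TL^G=\{u\in L^G:\dot u\in L^G,\ u(-T)=u(T)\}$ ($u$ absolutely continuous with weak derivative $\dot u$), with norm $\|u\|_{W^1L^G}=\|u\|_{L^G}+\|\dot u\|_{L^G}$. An embedding constant for $W^1_TL^G\hookrightarrow L^\infty$ is a constant $C>0$ with $\|u\|_{L^\infty}\le C\|u\|_{W^1L^G}$ for all $u\in W^1_TL^G$. "$\liminf_{|x|\to\infty}W/\max\{K,G\}>3$ uniformly in $t$" means: there are $\varepsilon_0,r>0$ with $W(t,x)\ge(3+\varepsilon_0)\max\{K(t,x),G(x)\}$ for all $|x|>r$ and all $t$; "$\liminf_{|x|\to\infty} K/|x|^p\ge b_1$ uniformly in $t$" means: for every $\varepsilon>0$ there is $r>0$ with $K(t,x)\ge(b_1-\varepsilon)|x|^p$ for all $|x|>r$ and all $t$. A solution is a function $u\in W^1_TL^G$ such that $t\mapsto\nabla G(\dot u(t))$ agrees a.e. with an absolutely continuous function whose derivative equals $V_x(t,u(t))+f(t)$ for a.e. $t\in[-T,T]$. *)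

theory Defs
  imports "HOL-Analysis.Analysis" "HOL-Probability.Essential_Supremum"
begin

definition gradient :: "('a::real_inner \<Rightarrow> real) \<Rightarrow> 'a \<Rightarrow> 'a" where
  "gradient f x = (THE D. GDERIV f x :> D)"

lemma gradient_eqI:
  assumes "GDERIV f x :> D"
  shows "gradient f x = D"
  unfolding gradient_def
proof (rule the_equality)
  fix D' assume "GDERIV f x :> D'"
  with assms have "(\<lambda>h. h \<bullet> D') = (\<lambda>h. h \<bullet> D)"
    unfolding gderiv_def by (intro has_derivative_unique)
  then have "(D' - D) \<bullet> (D' - D) = 0"
    by (metis inner_diff_right cancel_comm_monoid_add_class.diff_cancel)
  then show "D' = D" by simp
qed (fact assms)

text \<open>
  The derivative is taken within \<open>S\<close>, so for \<open>S = {-T..T} \<times> UNIV\<close> it is one-sided in time at the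
  two end points and extends continuously up to them.
\<close>
definition C1_on :: "'a::real_normed_vector set \<Rightarrow> ('a \<Rightarrow> 'b::real_normed_vector) \<Rightarrow> bool" where
  "C1_on S f \<longleftrightarrow>
     (\<exists>f'. (\<forall>z\<in>S. (f has_derivative blinfun_apply (f' z)) (at z within S)) \<and> continuous_on S f')"

definition G_function :: "('a::euclidean_space \<Rightarrow> real) \<Rightarrow> bool" where
  "G_function G \<longleftrightarrow>
     (\<forall>x. 0 \<le> G x) \<and> convex_on UNIV G \<and> (\<forall>x. G (- x) = G x) \<and> G 0 = 0 \<and>
     filterlim (\<lambda>x. G x / norm x) at_top at_infinity"

definition delta2 :: "('a::euclidean_space \<Rightarrow> real) \<Rightarrow> bool" where
  "delta2 G \<longleftrightarrow> (\<exists>K1>2. \<exists>M1\<ge>0. \<forall>x. norm x \<ge> M1 \<longrightarrow> G (2 *\<^sub>R x) \<le> K1 * G x)"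

definition nabla2 :: "('a::euclidean_space \<Rightarrow> real) \<Rightarrow> bool" where
  "nabla2 G \<longleftrightarrow> (\<exists>K2>1. \<exists>M2\<ge>0. \<forall>x. norm x \<ge> M2 \<longrightarrow> G x \<le> 1 / (2 * K2) * G (K2 *\<^sub>R x))"

definition dominated :: "('a::euclidean_space \<Rightarrow> real) \<Rightarrow> ('a \<Rightarrow> real) \<Rightarrow> bool" (infix "\<prec>\<^sub>G" 50) where
  "G1 \<prec>\<^sub>G G2 \<longleftrightarrow> (\<exists>M\<ge>0. \<exists>k>0. \<forall>x. norm x \<ge> M \<longrightarrow> G1 x \<le> G2 (k *\<^sub>R x))"

text \<open>For a G-function the supremum is finite, by superlinear growth.\<close>
definition fenchel_conj :: "('a::euclidean_space \<Rightarrow> real) \<Rightarrow> 'a \<Rightarrow> real" where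
  "fenchel_conj G y = (SUP x. x \<bullet> y - G x)"

text \<open>
  The upper limit is taken in the extended reals.  It is finite for a continuously differentiable
  G-function satisfying \<^const>\<open>delta2\<close>: by convexity
  \<open>G x \<le> x \<bullet> gradient G x \<le> G (2 *\<^sub>R x) - G x\<close>.
\<close>
definition q_infty :: "('a::euclidean_space \<Rightarrow> real) \<Rightarrow> real" where
  "q_infty G = real_of_ereal (Limsup at_infinity (\<lambda>x. ereal (x \<bullet> gradient G x / G x)))"

text \<open>
  The integrals that define membership and the norm are \<^typ>\<open>ennreal\<close>-valued, since the Bochner
  integral of a non-integrable function is 0.
\<close>
definition orlicz :: "real \<Rightarrow> ('a::euclidean_space \<Rightarrow> real) \<Rightarrow> (real \<Rightarrow> 'a) set" where
  "orlicz T G = {u. u \<in> borel_measurable (lebesgue_on {-T..T}) \<and>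
                    (\<integral>\<^sup>+t. ennreal (G (u t)) \<partial>lebesgue_on {-T..T}) < \<infinity>}"

definition luxemburg_norm :: "real \<Rightarrow> ('a::euclidean_space \<Rightarrow> real) \<Rightarrow> (real \<Rightarrow> 'a) \<Rightarrow> real" where
  "luxemburg_norm T G u =
     Inf {c. c > 0 \<and> (\<integral>\<^sup>+t. ennreal (G (u t /\<^sub>R c)) \<partial>lebesgue_on {-T..T}) \<le> 1}"

definition modular :: "real \<Rightarrow> ('a::euclidean_space \<Rightarrow> real) \<Rightarrow> (real \<Rightarrow> 'a) \<Rightarrow> real" where
  "modular T G u = (\<integral>t. G (u t) \<partial>lebesgue_on {-T..T})"

text \<open>
  \<open>P\<close> is a finite family of non-overlapping subintervals of \<open>[a,b]\<close>, each given by its end points.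
\<close>
definition abs_continuous_on :: "real \<Rightarrow> real \<Rightarrow> (real \<Rightarrow> 'a::real_normed_vector) \<Rightarrow> bool" where
  "abs_continuous_on a b u \<longleftrightarrow>
     (\<forall>\<epsilon>>0. \<exists>\<delta>>0. \<forall>P.
        finite P \<and> (\<forall>(s, t)\<in>P. a \<le> s \<and> s \<le> t \<and> t \<le> b) \<and>
        disjoint_family_on (\<lambda>(s, t). {s<..<t}) P \<and> (\<Sum>(s, t)\<in>P. t - s) < \<delta>
        \<longrightarrow> (\<Sum>(s, t)\<in>P. norm (u t - u s)) < \<epsilon>)"

text \<open>
  An absolutely continuous function is differentiable almost everywhere and its pointwise
  derivative represents its weak derivative.
\<close>
abbreviation dot :: "(real \<Rightarrow> 'a::real_normed_vector) \<Rightarrow> real \<Rightarrow> 'a" where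
  "dot u \<equiv> (\<lambda>t. vector_derivative u (at t))"

definition orlicz_sobolev :: "real \<Rightarrow> ('a::euclidean_space \<Rightarrow> real) \<Rightarrow> (real \<Rightarrow> 'a) set" where
  "orlicz_sobolev T G =
     {u. abs_continuous_on (- T) T u \<and> u \<in> orlicz T G \<and> dot u \<in> orlicz T G \<and> u (- T) = u T}"

definition orlicz_sobolev_norm :: "real \<Rightarrow> ('a::euclidean_space \<Rightarrow> real) \<Rightarrow> (real \<Rightarrow> 'a) \<Rightarrow> real" where
  "orlicz_sobolev_norm T G u = luxemburg_norm T G u + luxemburg_norm T G (dot u)"

definition embedding_constant :: "real \<Rightarrow> ('a::euclidean_space \<Rightarrow> real) \<Rightarrow> real \<Rightarrow> bool" where
  "embedding_constant T G C \<longleftrightarrow> C > 0 \<and>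
     (\<forall>u\<in>orlicz_sobolev T G.
        esssup (lebesgue_on {-T..T}) (\<lambda>t. ereal (norm (u t))) \<le> ereal (C * orlicz_sobolev_norm T G u))"

text \<open>
  \<open>d/dt P(t) = Q(t)\<close> for almost every \<open>t\<close>, where \<open>P\<close> is only determined up to null sets: it has an
  absolutely continuous representative \<open>w\<close> with derivative \<open>Q\<close>.
\<close>
definition ac_derivative :: "real \<Rightarrow> (real \<Rightarrow> 'a::euclidean_space) \<Rightarrow> (real \<Rightarrow> 'a) \<Rightarrow> bool" where
  "ac_derivative T P Q \<longleftrightarrow>
     (\<exists>w. abs_continuous_on (- T) T w \<and>
          (AE t in lebesgue_on {-T..T}. P t = w t) \<and>
          (AE t in lebesgue_on {-T..T}. (w has_vector_derivative Q t) (at t)))"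

definition euler_lagrange ::
  "real \<Rightarrow> (real \<Rightarrow> 'a::euclidean_space \<Rightarrow> 'a \<Rightarrow> real) \<Rightarrow> (real \<Rightarrow> 'a) \<Rightarrow> bool" where
  "euler_lagrange T L u \<longleftrightarrow>
     ac_derivative T (\<lambda>t. gradient (\<lambda>v. L t (u t) v) (dot u t))
                     (\<lambda>t. gradient (\<lambda>x. L t x (dot u t)) (u t))"

definition periodic_solution ::
  "real \<Rightarrow> ('a::euclidean_space \<Rightarrow> real) \<Rightarrow> (real \<Rightarrow> 'a \<Rightarrow> real) \<Rightarrow> (real \<Rightarrow> 'a) \<Rightarrow> (real \<Rightarrow> 'a) \<Rightarrow> bool"
where
  "periodic_solution T G V f u \<longleftrightarrow>
     u \<in> orlicz_sobolev T G \<and>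
     ac_derivative T (\<lambda>t. gradient G (dot u t)) (\<lambda>t. gradient (V t) (u t) + f t)"

end

theory Submission
  imports Defs "HOL-Complex_Analysis.Great_Picard"
begin

text \<open>
  By (A3), the Fenchel--Young inequality and the embedding, the action functional is at least
  \<open>min 1 (b - 1)\<close> times \<open>modular T G u + modular T G (dot u)\<close>, minus the left-hand side of the
  smallness assumption, as long as this sum of modulars is at most \<open>\<rho> / 2\<close>.  So the action is
  positive on the level set \<open>\<rho> / 2\<close>, while it vanishes at \<open>0\<close> by (A6): its minimum over the
  sublevel set is interior, and no mountain pass argument is needed.

  Weak compactness is avoided by minimising over functions on an equidistant grid.  The discrete
  Euler--Lagrange equation bounds the momenta \<open>g (slope x i)\<close>, and superlinearity of \<open>G\<close> then
  bounds the slopes uniformly.  Hence the interpolants converge uniformly along a subsequence and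
  the momenta converge pointwise, and Minty's monotonicity trick identifies the limit momentum with
  the gradient of \<open>G\<close> at the derivative of the limit.
\<close>

section \<open>Indefinite integrals and Lipschitz functions\<close>

text \<open>The level \<open>\<rho> / 2\<close> comes from comparing modulars with norms: a
  Luxemburg norm is at most \<open>max 1\<close> of its modular, so for
  \<open>\<rho> \<ge> 2\<close> a sum of modulars up to \<open>\<rho> / 2\<close> bounds each of the
  two norms by \<open>\<rho> / 2\<close>, and the embedding gives
  \<open>norm (u t) \<le> C * \<rho> = \<rho>\<^sub>0\<close>, exactly the range of
  \<open>A3\<close>. Of the \<open>b\<close> copies of \<open>G\<close> in \<open>A3\<close>, one
  absorbs the forcing term; \<open>b - 1\<close> remain for \<open>u\<close>, and the
  \<open>1\<close> in the minimum is the coefficient of \<open>G (dot u)\<close>.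

  The obstacle in the limit is the nonlinear map \<open>g\<close>: the slopes are controlled only
  through their integrals, so \<open>g\<close> of a slope cannot be passed to the limit directly.
  The momenta behave better, being a convergent constant plus integrals of forces dominated by one
  integrable function, and the monotonicity inequality is linear in the slope once the momentum is
  replaced by its limit.

  Two facts about functions of one variable lead from the integrated equation to the required notion
  of solution: primitives are differentiable almost everywhere with the integrand as derivative, and
  Lipschitz functions are primitives.\<close>

lemma negligible_averages_far_from_value:
  fixes f :: "real \<Rightarrow> 'a::euclidean_space"
  assumes f: "f integrable_on {a..b}" and e: "e > 0"
  shows "negligible {x\<in>{a..b}. \<forall>\<delta>>0. \<exists>c d. a \<le> c \<and> c \<le> x \<and> x \<le> d \<and> d \<le> b \<and> c < d \<and> d - c < \<delta> \<and>
            norm ((d - c) *\<^sub>R f x - integral {c..d} f) > e * (d - c)}" (is "negligible ?B")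
  unfolding negligible_outer_le
proof (intro allI impI)
  fix \<epsilon> :: real assume "\<epsilon> > 0"
  \<comment> \<open>Each bad interval contributes more than \<open>e\<close> times its length to a
    Henstock sum, so a sum below \<open>e * \<epsilon>\<close> bounds the total length of disjoint
    bad intervals by \<open>\<epsilon>\<close>.\<close>
  with e have "e * \<epsilon> > 0" by simp
  then obtain \<gamma> where "gauge \<gamma>"
    and \<gamma>: "\<And>p. \<lbrakk>p tagged_partial_division_of (cbox a b); \<gamma> fine p\<rbrakk> \<Longrightarrow>
             (\<Sum>(x,k)\<in>p. norm (measure lborel k *\<^sub>R f x - integral k f)) < e * \<epsilon>"
    using Henstock_lemma[of f a b "e * \<epsilon>"] f by (auto simp: cbox_interval)
  \<comment> \<open>Bad intervals with tag \<open>x\<close>, small enough to be fine for the gauge;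
    they form a Vitali cover of the exceptional set.\<close>
  define K where "K = {(x, c, d). x \<in> {a..b} \<and> a \<le> c \<and> c \<le> x \<and> x \<le> d \<and> d \<le> b \<and> c < d \<and>
      {c..d} \<subseteq> \<gamma> x \<and> norm ((d - c) *\<^sub>R f x - integral {c..d} f) > e * (d - c)}"
  \<comment> \<open>Vitali's theorem is applied to balls, so an interval is encoded by its midpoint
    and half its length.\<close>
  define m where "m = (\<lambda>(x::real, c::real, d::real). (c + d) / 2)"
  define r where "r = (\<lambda>(x::real, c::real, d::real). (d - c) / 2)"
  have cb: "cball (m i) (r i) = (case i of (x, c, d) \<Rightarrow> {c..d})" for i
    by (cases i) (auto simp: m_def r_def cball_eq_atLeastAtMost field_simps)
  obtain C where C: "countable C" "C \<subseteq> K"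
     "pairwise (\<lambda>i j. disjnt (cball (m i) (r i)) (cball (m j) (r j))) C"
     "negligible (?B - (\<Union>i \<in> C. cball (m i) (r i)))"
  proof (rule Vitali_covering_theorem_cballs[of K r ?B m])
    show "0 < r i" if "i \<in> K" for i using that by (auto simp: K_def r_def)
    fix x \<eta> :: real assume x: "x \<in> ?B" and "\<eta> > 0"
    from \<open>gauge \<gamma>\<close> have "x \<in> \<gamma> x" "open (\<gamma> x)" by (auto simp: gauge_def)
    then obtain s where s: "s > 0" "ball x s \<subseteq> \<gamma> x"
      using open_contains_ball by blast
    define \<delta> where "\<delta> = min \<eta> s"
    have "\<delta> > 0" using s \<open>\<eta> > 0\<close> by (simp add: \<delta>_def)
    with x obtain c d where cd: "a \<le> c" "c \<le> x" "x \<le> d" "d \<le> b" "c < d" "d - c < \<delta>"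
      "norm ((d - c) *\<^sub>R f x - integral {c..d} f) > e * (d - c)"
      by blast
    have "{c..d} \<subseteq> ball x s" using cd by (auto simp: dist_real_def \<delta>_def)
    with s have "{c..d} \<subseteq> \<gamma> x" by blast
    with cd x have "(x, c, d) \<in> K" by (auto simp: K_def)
    moreover have "x \<in> cball (m (x,c,d)) (r (x,c,d))" using cd by (simp add: cb)
    moreover have "r (x,c,d) < \<eta>" using cd by (simp add: r_def \<delta>_def)
    ultimately show "\<exists>i. i \<in> K \<and> x \<in> cball (m i) (r i) \<and> r i < \<eta>" by blast
  qed
  \<comment> \<open>A bound uniform over finite subfamilies carries over to the whole Vitali family,
    which is countable.\<close>
  have bd: "measure lebesgue (\<Union>i\<in>F. cball (m i) (r i)) \<le> \<epsilon>" if F: "F \<subseteq> C" "finite F" for F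
  proof -
    define g where "g = (\<lambda>(x::real, c::real, d::real). (x, {c..d}))"
    have FK: "F \<subseteq> K" using F C by auto
    have disj: "snd (g i) \<inter> snd (g j) = {}" if "i \<in> F" "j \<in> F" "i \<noteq> j" for i j
    proof -
      have "i \<in> C" "j \<in> C" using F that by auto
      then have "disjnt (cball (m i) (r i)) (cball (m j) (r j))"
        using C(3) that by (auto simp: pairwise_def)
      then show ?thesis unfolding cb by (auto simp: disjnt_def g_def split: prod.splits)
    qed
    have ne: "snd (g i) \<noteq> {}" if "i \<in> F" for i
      using FK that by (auto simp: K_def g_def)
    have inj: "inj_on g F"
      by (rule inj_onI) (metis disj ne inf.idem)
    have part: "(g ` F) tagged_partial_division_of (cbox a b)"
      unfolding tagged_partial_division_of_def
    proof (intro conjI allI impI; (elim conjE)?)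
      show "finite (g ` F)" using F by simp
    next
      fix x k assume xk: "(x, k) \<in> g ` F"
      then obtain c d where "(x, c, d) \<in> F" "k = {c..d}" by (auto simp: g_def)
      then have *: "(x, c, d) \<in> K" "k = cbox c d" using FK by (auto simp: cbox_interval)
      then show "x \<in> k" "k \<subseteq> cbox a b" "\<exists>a b. k = cbox a b" by (auto simp: K_def cbox_interval)
    next
      fix x k x' k' assume "(x, k) \<in> g ` F" "(x', k') \<in> g ` F" "(x, k) \<noteq> (x', k')"
      then have "k \<inter> k' = {}" using disj by (metis imageE snd_conv)
      then show "interior k \<inter> interior k' = {}" using interior_subset by fast
    qed
    have fine: "\<gamma> fine (g ` F)"
      unfolding fine_def using FK by (auto simp: g_def K_def)
    have "measure lebesgue (\<Union>i\<in>F. cball (m i) (r i)) \<le> (\<Sum>i\<in>F. measure lebesgue (cball (m i) (r i)))"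
      using F(2) by (rule measure_UNION_le) auto
    also have "\<dots> = (\<Sum>(x, c, d)\<in>F. d - c)"
      using FK by (intro sum.cong refl) (auto simp: cb K_def split: prod.splits)
    finally have 1: "e * measure lebesgue (\<Union>i\<in>F. cball (m i) (r i)) \<le> e * (\<Sum>(x, c, d)\<in>F. d - c)"
      using e by simp
    have "e * (\<Sum>(x, c, d)\<in>F. d - c) = (\<Sum>(x, c, d)\<in>F. e * (d - c))"
      by (simp add: sum_distrib_left split_def)
    also have "\<dots> \<le> (\<Sum>(x, c, d)\<in>F. norm (measure lborel {c..d} *\<^sub>R f x - integral {c..d} f))"
      using FK by (intro sum_mono) (auto simp: K_def split: prod.splits)
    also have "\<dots> = (\<Sum>(x, k)\<in>g ` F. norm (measure lborel k *\<^sub>R f x - integral k f))"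
      by (subst sum.reindex[OF inj]) (auto simp: g_def intro!: sum.cong)
    also have "\<dots> < e * \<epsilon>" using \<gamma>[OF part fine] .
    finally show ?thesis using 1 e by simp
  qed
  let ?U = "\<Union>i\<in>C. cball (m i) (r i)"
  have U: "?U \<in> lmeasurable" "measure lebesgue ?U \<le> \<epsilon>"
    using fmeasurable_UN_bound[OF C(1) _ bd] measure_UN_bound[OF C(1) _ bd] by auto
  let ?N = "?B - ?U"
  have "?B \<subseteq> ?U \<union> ?N" by blast
  moreover have "?U \<union> ?N \<in> lmeasurable"
    using U C(4) by (intro fmeasurable.Un) (auto simp: negligible_imp_measurable)
  moreover have "measure lebesgue (?U \<union> ?N) \<le> \<epsilon>"
    using U C(4) measure_Un_le[of ?U lebesgue ?N] 
    by (auto simp: negligible_imp_measurable negligible_imp_measure0 fmeasurableD)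
  ultimately show "\<exists>T. ?B \<subseteq> T \<and> T \<in> lmeasurable \<and> measure lebesgue T \<le> \<epsilon>" by blast
qed

text \<open>Lebesgue's differentiation theorem for gauge integrable functions: a countable union of
  the exceptional sets for \<open>e = 1 / (n + 1)\<close>. In those sets \<open>x\<close> may be an
  end point of \<open>{c..d}\<close>, so both one-sided difference quotients are covered;
  \<open>a\<close> and \<open>b\<close> are discarded because the derivative is two-sided.\<close>

lemma negligible_indefinite_integral_not_differentiable:
  fixes f :: "real \<Rightarrow> 'a::euclidean_space"
  assumes f: "f integrable_on {a..b}"
  shows "negligible {x\<in>{a..b}. \<not> ((\<lambda>t. integral {a..t} f) has_vector_derivative f x) (at x)}"
proof -
  define B where "B = (\<lambda>e. {x\<in>{a..b}. \<forall>\<delta>>0. \<exists>c d. a \<le> c \<and> c \<le> x \<and> x \<le> d \<and> d \<le> b \<and> c < d \<and> d - c < \<delta> \<and>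
            norm ((d - c) *\<^sub>R f x - integral {c..d} f) > e * (d - c)})"
  have "negligible (\<Union>n::nat. B (inverse (real (Suc n))))"
    unfolding B_def by (intro negligible_Union_nat negligible_averages_far_from_value f) simp
  then have neg: "negligible ({a, b} \<union> (\<Union>n::nat. B (inverse (real (Suc n)))))"
    by (intro negligible_Un) auto
  have "((\<lambda>t. integral {a..t} f) has_vector_derivative f x) (at x)"
    if x: "x \<in> {a..b}" and nx: "x \<notin> {a, b} \<union> (\<Union>n::nat. B (inverse (real (Suc n))))" for x
  proof -
    have ax: "a < x" "x < b" using x nx by auto
    have "((\<lambda>t. integral {a..t} f) has_derivative (\<lambda>h. h *\<^sub>R f x)) (at x)"
      unfolding has_derivative_at_alt
    proof (intro conjI allI impI bounded_linear_scaleR_left)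
      fix e :: real assume "e > 0"
      then obtain n :: nat where n: "inverse (real (Suc n)) < e" using reals_Archimedean by blast
      let ?e = "inverse (real (Suc n))"
      have "x \<notin> B ?e" using nx by auto
      then obtain \<delta> where \<delta>0: "\<delta> > 0" and \<delta>1: "\<not> (\<exists>c d. a \<le> c \<and> c \<le> x \<and> x \<le> d \<and> d \<le> b \<and> c < d \<and>
            d - c < \<delta> \<and> norm ((d - c) *\<^sub>R f x - integral {c..d} f) > ?e * (d - c))"
        using x unfolding B_def by blast
      then have \<delta>: "norm ((d - c) *\<^sub>R f x - integral {c..d} f) \<le> ?e * (d - c)"
        if "a \<le> c" "c \<le> x" "x \<le> d" "d \<le> b" "c < d" "d - c < \<delta>" for c d
        using that not_less by blast
      define \<eta> where "\<eta> = min \<delta> (min (x - a) (b - x))"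
      have "\<eta> > 0" using \<delta>0 ax by (simp add: \<eta>_def)
      moreover have "norm (integral {a..y} f - integral {a..x} f - (y - x) *\<^sub>R f x) \<le> e * norm (y - x)"
        if y: "norm (y - x) < \<eta>" for y
      proof -
        have ybd: "a \<le> y" "y \<le> b" "\<bar>y - x\<bar> < \<delta>" using y by (auto simp: \<eta>_def)
        have fi: "f integrable_on {a..c}" if "c \<le> b" for c
          using f that integrable_on_subinterval[OF f, of a c] by (cases "a \<le> c") auto
        consider "x < y" | "x = y" | "y < x" by linarith
        then show ?thesis
        proof cases
          case 1
          have "integral {a..x} f + integral {x..y} f = integral {a..y} f"
            using 1 ybd ax fi by (intro Henstock_Kurzweil_Integration.integral_combine) auto
          then have "norm (integral {a..y} f - integral {a..x} f - (y - x) *\<^sub>R f x) =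
              norm ((y - x) *\<^sub>R f x - integral {x..y} f)"
            by (metis add_diff_cancel_left' norm_minus_commute)
          also have "\<dots> \<le> ?e * (y - x)" using \<delta>[of x y] 1 ybd ax by auto
          also have "\<dots> \<le> e * norm (y - x)" using 1 n by auto
          finally show ?thesis .
        next
          case 3
          have "integral {a..y} f + integral {y..x} f = integral {a..x} f"
            using 3 ybd ax fi by (intro Henstock_Kurzweil_Integration.integral_combine) auto
          then have "integral {a..y} f - integral {a..x} f - (y - x) *\<^sub>R f x = (x - y) *\<^sub>R f x - integral {y..x} f"
            by (simp add: algebra_simps)
          moreover have "norm ((x - y) *\<^sub>R f x - integral {y..x} f) \<le> ?e * (x - y)" 
            using \<delta>[of y x] 3 ybd ax by auto
          moreover have "?e * (x - y) \<le> e * norm (y - x)" using 3 n by auto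
          ultimately show ?thesis by simp
        qed simp
      qed
      ultimately show "\<exists>\<eta>>0. \<forall>y. norm (y - x) < \<eta> \<longrightarrow>
          norm (integral {a..y} f - integral {a..x} f - (y - x) *\<^sub>R f x) \<le> e * norm (y - x)"
        by blast
    qed
    then show ?thesis by (simp add: has_vector_derivative_def)
  qed
  then show ?thesis by (intro negligible_subset[OF neg]) blast
qed

text \<open>The function \<open>g\<close> is cut off to each open interval; at every point at most
  one cut-off is nonzero, so their sum stays below \<open>g\<close>. Open intervals are used because
  members of \<open>P\<close> may share end points.\<close>

lemma sum_integral_subintervals_le:
  fixes g :: "real \<Rightarrow> real"
  assumes g: "g integrable_on {a..b}" "\<And>x. x \<in> {a..b} \<Longrightarrow> 0 \<le> g x"
    and P: "finite P" "\<forall>(s, t)\<in>P. a \<le> s \<and> s \<le> t \<and> t \<le> b"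
      "disjoint_family_on (\<lambda>(s, t). {s<..<t}) P"
  shows "(\<Sum>(s, t)\<in>P. integral {s..t} g) \<le> integral {a..b} g"
proof -
  let ?h = "\<lambda>(s, t) x. if x \<in> {s<..<t} then g x else 0"
  have h: "(?h (s, t) has_integral integral {s..t} g) {a..b}" if "(s, t) \<in> P" for s t
  proof -
    have st: "a \<le> s" "s \<le> t" "t \<le> b" using P(2) that by auto
    then have "(g has_integral integral {s..t} g) {s..t}"
      by (intro integrable_integral integrable_on_subinterval[OF g(1)]) auto
    then have "(g has_integral integral {s..t} g) {s<..<t}"
      by (simp add: has_integral_Icc_iff_Ioo)
    then show ?thesis
      using st has_integral_restrict[of "{s<..<t}" "{a..b}" g] by (auto simp: subset_eq)
  qed
  have "((\<lambda>x. \<Sum>p\<in>P. ?h p x) has_integral (\<Sum>(s, t)\<in>P. integral {s..t} g)) {a..b}"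
    using P(1) h by (intro has_integral_sum) auto
  moreover have "(\<Sum>p\<in>P. ?h p x) \<le> g x" if x: "x \<in> {a..b}" for x
  proof (cases "\<exists>p\<in>P. x \<in> (case p of (s, t) \<Rightarrow> {s<..<t})")
    case True
    then obtain p where p: "p \<in> P" "x \<in> (case p of (s, t) \<Rightarrow> {s<..<t})" by auto
    have "?h q x = 0" if q: "q \<in> P - {p}" for q
    proof -
      have "(case q of (s, t) \<Rightarrow> {s<..<t}) \<inter> (case p of (s, t) \<Rightarrow> {s<..<t}) = {}"
        using P(3) p(1) q unfolding disjoint_family_on_def by blast
      then have "x \<notin> (case q of (s, t) \<Rightarrow> {s<..<t})" using p(2) by blast
      then show ?thesis by (auto split: prod.splits)
    qed
    then have "(\<Sum>q\<in>P. ?h q x) = ?h p x"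
      using P(1) p(1) by (subst sum.remove[of P p]) (auto intro!: sum.neutral)
    then show ?thesis using p by (auto split: prod.splits)
  next
    case False
    then have "(\<Sum>q\<in>P. ?h q x) = 0" by (intro sum.neutral) (auto split: prod.splits)
    then show ?thesis using g(2)[OF x] by simp
  qed
  ultimately show ?thesis
    using has_integral_le[OF _ integrable_integral[OF g(1)]] by blast
qed

text \<open>Splits \<open>norm (f x)\<close> into its excess over a level \<open>n\<close>, whose
  integral is small for large \<open>n\<close> by dominated convergence, and a part at most
  \<open>n\<close>, which contributes at most \<open>n\<close> times the total length of the
  intervals.\<close>

lemma abs_continuous_on_indefinite_integral:
  fixes f :: "real \<Rightarrow> 'a::euclidean_space"
  assumes f: "f absolutely_integrable_on {a..b}"
  shows "abs_continuous_on a b (\<lambda>t. c + integral {a..t} f)"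
  unfolding abs_continuous_on_def
proof (intro allI impI)
  fix \<epsilon> :: real assume \<epsilon>: "\<epsilon> > 0"
  define g where "g = (\<lambda>n x. max 0 (norm (f x) - real n))"
  have nf: "(\<lambda>x. norm (f x)) absolutely_integrable_on {a..b}"
    using f by (rule set_integrable_norm)
  have gi: "g n integrable_on {a..b}" for n
    unfolding g_def
    by (intro set_lebesgue_integral_eq_integral(1) absolutely_integrable_max_1 set_integral_diff nf)
       (auto simp: absolutely_integrable_on_const)
  have "(\<lambda>n. integral {a..b} (g n)) \<longlonglongrightarrow> integral {a..b} (\<lambda>x. 0::real)"
  proof (rule dominated_convergence(2)[where h = "\<lambda>x. norm (f x)"])
    show "(\<lambda>x. norm (f x)) integrable_on {a..b}" using nf set_lebesgue_integral_eq_integral(1) by blast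
    show "(\<lambda>n. g n x) \<longlonglongrightarrow> 0" for x
    proof -
      obtain N :: nat where "norm (f x) \<le> real N" using real_arch_simple by blast
      then have "eventually (\<lambda>n. g n x = 0) sequentially"
        by (intro eventually_sequentiallyI[of N]) (auto simp: g_def)
      then show ?thesis by (rule tendsto_eventually)
    qed
  qed (auto simp: gi, auto simp: g_def)
  then have "eventually (\<lambda>n. integral {a..b} (g n) < \<epsilon>/2) sequentially"
    using \<epsilon> by (intro order_tendstoD(2)) auto
  then obtain n where n: "integral {a..b} (g n) < \<epsilon>/2" by (meson eventually_sequentially order_refl)
  \<comment> \<open>The summand \<open>1\<close> keeps the quotient meaningful for
    \<open>n = 0\<close>; \<open>n * \<delta>\<close> is still below
    \<open>\<epsilon> / 2\<close>.\<close>
  define \<delta> where "\<delta> = \<epsilon> / (2 * (real n + 1))"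
  have "\<delta> > 0" using \<epsilon> by (simp add: \<delta>_def)
  moreover have "(\<Sum>(s, t)\<in>P. norm ((c + integral {a..t} f) - (c + integral {a..s} f))) < \<epsilon>"
    if P: "finite P" "\<forall>(s, t)\<in>P. a \<le> s \<and> s \<le> t \<and> t \<le> b"
      "disjoint_family_on (\<lambda>(s, t). {s<..<t}) P" "(\<Sum>(s, t)\<in>P. t - s) < \<delta>" for P
  proof -
    have "norm ((c + integral {a..t} f) - (c + integral {a..s} f)) \<le> integral {s..t} (g n) + real n * (t - s)"
      if "(s, t) \<in> P" for s t
    proof -
      have st: "a \<le> s" "s \<le> t" "t \<le> b" using P(2) that by auto
      have "f integrable_on {a..t}"
        by (rule integrable_on_subinterval[of _ "{a..b}"])
           (use f st set_lebesgue_integral_eq_integral(1) in auto)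
      then have "integral {a..s} f + integral {s..t} f = integral {a..t} f"
        using st by (intro Henstock_Kurzweil_Integration.integral_combine) auto
      then have "norm ((c + integral {a..t} f) - (c + integral {a..s} f)) = norm (integral {s..t} f)"
        by (metis add_diff_cancel_left add_diff_cancel_left')
      also have "\<dots> \<le> integral {s..t} (\<lambda>x. g n x + real n)"
      proof (rule integral_norm_bound_integral)
        show "f integrable_on {s..t}"
          by (rule integrable_on_subinterval[of _ "{a..b}"])
             (use f st set_lebesgue_integral_eq_integral(1) in auto)
        show "(\<lambda>x. g n x + real n) integrable_on {s..t}"
          by (rule integrable_on_subinterval[of _ "{a..b}"]) (use gi st in \<open>auto intro!: integrable_add\<close>)
      qed (auto simp: g_def)
      also have "\<dots> = integral {s..t} (g n) + real n * (t - s)"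
        using integrable_on_subinterval[OF gi, of s t n] st
        by (subst integral_add) auto
      finally show ?thesis .
    qed
    then have "(\<Sum>(s, t)\<in>P. norm ((c + integral {a..t} f) - (c + integral {a..s} f)))
        \<le> (\<Sum>(s, t)\<in>P. integral {s..t} (g n) + real n * (t - s))"
      by (intro sum_mono) auto
    also have "\<dots> = (\<Sum>(s, t)\<in>P. integral {s..t} (g n)) + real n * (\<Sum>(s, t)\<in>P. t - s)"
      by (simp add: sum.distrib sum_distrib_left split_def)
    also have "\<dots> \<le> \<epsilon>/2 + real n * \<delta>"
    proof (intro add_mono)
      have "(\<Sum>(s, t)\<in>P. integral {s..t} (g n)) \<le> integral {a..b} (g n)"
        by (rule sum_integral_subintervals_le[OF gi _ P(1,2,3)]) (simp add: g_def)
      then show "(\<Sum>(s, t)\<in>P. integral {s..t} (g n)) \<le> \<epsilon>/2" using n by simp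
    qed (use P(4) in \<open>auto intro: mult_left_mono\<close>)
    also have "\<dots> < \<epsilon>" using \<epsilon> by (simp add: \<delta>_def field_simps)
    finally show ?thesis .
  qed
  ultimately show "\<exists>\<delta>>0. \<forall>P. finite P \<and> (\<forall>(s, t)\<in>P. a \<le> s \<and> s \<le> t \<and> t \<le> b) \<and>
        disjoint_family_on (\<lambda>(s, t). {s<..<t}) P \<and> (\<Sum>(s, t)\<in>P. t - s) < \<delta>
        \<longrightarrow> (\<Sum>(s, t)\<in>P. norm ((c + integral {a..t} f) - (c + integral {a..s} f))) < \<epsilon>"
    by blast
qed

section \<open>Lipschitz functions as primitives\<close>

lemma emeasure_interval_measure_Ioo:
  assumes "\<And>x y. x \<le> y \<Longrightarrow> F x \<le> F y" "continuous_on UNIV F" "a \<le> b"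
  shows "emeasure (interval_measure F) {a<..<b} = ennreal (F b - F a)"
proof (cases "a = b")
  case False
  have c: "\<And>x. continuous (at_right x) F"
    using assms(2) continuous_on_imp_continuous_within by (auto simp: continuous_on_eq_continuous_within intro: continuous_at_imp_continuous_at_within)
  have 0: "emeasure (interval_measure F) {b} = 0"
    using emeasure_interval_measure_Icc[of b b F] assms by auto
  have "emeasure (interval_measure F) {a<..b} = emeasure (interval_measure F) ({a<..<b} \<union> {b})"
    using False assms(3) by (intro arg_cong[where f="emeasure _"]) auto
  also have "\<dots> = emeasure (interval_measure F) {a<..<b} + emeasure (interval_measure F) {b}"
    by (intro plus_emeasure[symmetric]) auto
  finally show ?thesis using emeasure_interval_measure_Ioc[OF assms(3,1) c] 0 by simp
qed simp

text \<open>Radon-Nikodym: \<open>t / 2 + u / (2 * Q)\<close> and \<open>t / 2 - u / (2 * Q)\<close>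
  are both nondecreasing and add up to \<open>t\<close>, so their Stieltjes measures add up to
  Lebesgue measure. The first is therefore dominated by it and has a density, from which that of
  \<open>u\<close> is read off.\<close>

lemma Lipschitz_has_density:
  fixes u :: "real \<Rightarrow> real"
  assumes u: "\<And>s t. s \<in> {a..b} \<Longrightarrow> t \<in> {a..b} \<Longrightarrow> \<bar>u t - u s\<bar> \<le> R * \<bar>t - s\<bar>" and ab: "a \<le> b"
  shows "\<exists>v. v absolutely_integrable_on {a..b} \<and> (\<forall>t\<in>{a..b}. u t = u a + integral {a..t} v)"
proof -
  \<comment> \<open>Strictly positive whatever the sign of \<open>R\<close>, because the
    construction divides by it.\<close>
  define Q where "Q = \<bar>R\<bar> + 1"
  have Q: "Q > 0" "R \<le> Q" by (auto simp: Q_def)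
  \<comment> \<open>Clamping extends \<open>u\<close> constantly beyond \<open>{a..b}\<close>
    without spoiling the Lipschitz bound; interval measures need a function on the whole
    line.\<close>
  define c where "c = (\<lambda>t. max a (min b t))"
  have c: "c t \<in> {a..b}" "\<bar>c t - c s\<bar> \<le> \<bar>t - s\<bar>" for s t using ab by (auto simp: c_def)
  have uc: "\<bar>u (c t) - u (c s)\<bar> \<le> Q * \<bar>t - s\<bar>" for s t
  proof -
    have "\<bar>u (c t) - u (c s)\<bar> \<le> R * \<bar>c t - c s\<bar>" using u c by auto
    also have "\<dots> \<le> Q * \<bar>t - s\<bar>" using Q c by (intro mult_mono) auto
    finally show ?thesis .
  qed
  define \<phi> where "\<phi> = (\<lambda>t. t / 2 + u (c t) / (2 * Q))"
  define \<psi> where "\<psi> = (\<lambda>t. t / 2 - u (c t) / (2 * Q))"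
  have mono: "\<phi> s \<le> \<phi> t" "\<psi> s \<le> \<psi> t" if "s \<le> t" for s t
  proof -
    have "\<bar>u (c t) - u (c s)\<bar> / (2 * Q) \<le> (t - s) / 2"
      using uc[of t s] that Q by (simp add: field_simps)
    moreover have "\<bar>u (c t) - u (c s)\<bar> / (2 * Q) = \<bar>u (c t) / (2 * Q) - u (c s) / (2 * Q)\<bar>"
      using Q by (simp add: diff_divide_distrib[symmetric])
    ultimately have "\<bar>u (c t) / (2 * Q) - u (c s) / (2 * Q)\<bar> \<le> (t - s) / 2" by simp
    then show "\<phi> s \<le> \<phi> t" "\<psi> s \<le> \<psi> t" by (auto simp: \<phi>_def \<psi>_def abs_le_iff diff_divide_distrib)
  qed
  have "Q-lipschitz_on UNIV (\<lambda>t. u (c t))"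
    using uc Q by (intro lipschitz_onI) (auto simp: dist_real_def abs_minus_commute)
  then have "continuous_on UNIV (\<lambda>t. u (c t))" by (rule lipschitz_on_continuous_on)
  then have cont: "continuous_on UNIV \<phi>" "continuous_on UNIV \<psi>"
    unfolding \<phi>_def \<psi>_def using Q(1) by (auto intro!: continuous_intros)
  define N1 N2 where "N1 = interval_measure \<phi>" and "N2 = interval_measure \<psi>"
  have sets: "sets N1 = sets borel" "sets N2 = sets borel" by (auto simp: N1_def N2_def)
  define M where "M = measure_of UNIV (sets borel) (\<lambda>A. emeasure N1 A + emeasure N2 A)"
  have M: "emeasure M A = emeasure N1 A + emeasure N2 A" if "A \<in> sets borel" for A
    unfolding M_def
  proof (rule emeasure_measure_of_sigma)
    show "sigma_algebra UNIV (sets borel :: real set set)"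
      using sets.sigma_algebra_axioms[of borel] by simp
    show "positive (sets borel) (\<lambda>A. emeasure N1 A + emeasure N2 A)" by (simp add: positive_def)
    show "countably_additive (sets borel) (\<lambda>A. emeasure N1 A + emeasure N2 A)"
    proof (rule countably_additiveI)
      fix A :: "nat \<Rightarrow> real set" assume A: "range A \<subseteq> sets borel" "disjoint_family A"
      have "(\<Sum>i. emeasure N1 (A i) + emeasure N2 (A i)) = (\<Sum>i. emeasure N1 (A i)) + (\<Sum>i. emeasure N2 (A i))"
        by (rule suminf_add[symmetric]) auto
      then show "(\<Sum>i. emeasure N1 (A i) + emeasure N2 (A i)) = emeasure N1 (\<Union> (range A)) + emeasure N2 (\<Union> (range A))"
        using A by (simp add: suminf_emeasure sets)
    qed
  qed (use that in auto)
  \<comment> \<open>Both sides give a box the length \<open>r - l\<close>, since the increments of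
    \<open>\<phi>\<close> and \<open>\<psi>\<close> add up to it.\<close>
  have "lborel = M"
  proof (rule lborel_eqI)
    fix l r :: real assume "\<And>b. b \<in> Basis \<Longrightarrow> l \<bullet> b \<le> r \<bullet> b"
    then have lr: "l \<le> r" by simp
    have "emeasure M (box l r) = ennreal (\<phi> r - \<phi> l) + ennreal (\<psi> r - \<psi> l)"
      using lr by (simp add: M N1_def N2_def emeasure_interval_measure_Ioo mono cont)
    also have "\<dots> = ennreal ((\<phi> r - \<phi> l) + (\<psi> r - \<psi> l))"
      using mono lr by (intro ennreal_plus[symmetric]) auto
    also have "(\<phi> r - \<phi> l) + (\<psi> r - \<psi> l) = r - l" by (simp add: \<phi>_def \<psi>_def)
    finally show "emeasure M (box l r) = ennreal (\<Prod>b\<in>Basis. (r - l) \<bullet> b)" by simp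
  qed (simp add: M_def sets.sigma_sets_eq[of borel, unfolded space_borel])
  then have le: "emeasure N1 A \<le> emeasure lborel A" if "A \<in> sets borel" for A
    using M[OF that] by simp
  have "absolutely_continuous lborel N1"
    unfolding absolutely_continuous_def
  proof
    fix A :: "real set" assume "A \<in> null_sets lborel"
    then have "A \<in> sets borel" "emeasure lborel A = 0" by auto
    then show "A \<in> null_sets N1" using le[of A] by (auto simp: null_sets_def sets)
  qed
  then obtain w where w: "w \<in> borel_measurable lborel" "density lborel w = N1"
    using sigma_finite_measure.Radon_Nikodym[OF sigma_finite_lborel, of N1] sets by auto
  define v1 where "v1 = (\<lambda>x. enn2real (w x))"
  have v1m: "v1 \<in> borel_measurable borel" using w(1) by (simp add: v1_def)
  have v1: "(v1 has_integral (\<phi> t - \<phi> a)) {a..t}" if t: "a \<le> t" for t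
  proof -
    have "emeasure N1 {a<..<t} = (\<integral>\<^sup>+x. w x * indicator {a<..<t} x \<partial>lborel)"
      using w by (subst w(2)[symmetric], subst emeasure_density) auto
    moreover have "emeasure N1 {a<..<t} = ennreal (\<phi> t - \<phi> a)"
      unfolding N1_def by (rule emeasure_interval_measure_Ioo) (use mono cont t in auto)
    ultimately have eq: "(\<integral>\<^sup>+x. w x * indicator {a<..<t} x \<partial>lborel) = ennreal (\<phi> t - \<phi> a)" by simp
    have "AE x in lborel. w x * indicator {a<..<t} x \<noteq> \<infinity>"
      using eq w(1) by (intro nn_integral_PInf_AE) auto
    then have "AE x in lborel. w x * indicator {a<..<t} x = ennreal (v1 x * indicator {a<..<t} x)"
      by eventually_elim (auto simp: v1_def indicator_def top.not_eq_extremum)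
    then have "(\<integral>\<^sup>+x. ennreal (v1 x * indicator {a<..<t} x) \<partial>lborel) = ennreal (\<phi> t - \<phi> a)"
      unfolding eq[symmetric] by (intro nn_integral_cong_AE) auto
    then have "((\<lambda>x. v1 x * indicator {a<..<t} x) has_integral (\<phi> t - \<phi> a)) UNIV"
      using v1m mono t by (intro nn_integral_has_integral) (auto simp: v1_def)
    then have "((\<lambda>x. if x \<in> {a<..<t} then v1 x else 0) has_integral (\<phi> t - \<phi> a)) UNIV"
      by (rule has_integral_eq[rotated]) (auto simp: indicator_def)
    then show ?thesis by (simp only: has_integral_restrict_UNIV has_integral_Icc_iff_Ioo)
  qed
  have v1a: "v1 absolutely_integrable_on {a..b}"
    using v1[OF ab] by (intro nonnegative_absolutely_integrable_1) (auto simp: v1_def)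
  show ?thesis
  proof (intro exI conjI ballI)
    \<comment> \<open>Inverts \<open>\<phi> = t / 2 + u / (2 * Q)\<close> at the level of
      densities.\<close>
    show "(\<lambda>x. 2 * Q * v1 x - Q) absolutely_integrable_on {a..b}"
      using v1a by (intro set_integral_diff) (auto simp: absolutely_integrable_on_const)
    fix t assume t: "t \<in> {a..b}"
    have "((\<lambda>x. 2 * Q * v1 x - Q) has_integral (2 * Q * (\<phi> t - \<phi> a) - (t - a) *\<^sub>R Q)) {a..t}"
      using v1[of t] t has_integral_const_real[of Q a t]
      by (intro has_integral_diff has_integral_mult_right) auto
    moreover have "2 * Q * (\<phi> t - \<phi> a) - (t - a) *\<^sub>R Q = u t - u a"
    proof -
      have "c t = t" "c a = a" using t ab by (auto simp: c_def)
      then have "\<phi> t - \<phi> a = (t - a) / 2 + (u t - u a) / (2 * Q)"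
        by (simp add: \<phi>_def diff_divide_distrib)
      moreover have "2 * Q * ((t - a) / 2 + (u t - u a) / (2 * Q)) = Q * (t - a) + (u t - u a)"
        using Q by (simp add: distrib_left)
      ultimately show ?thesis by (simp add: mult.commute)
    qed
    ultimately have "integral {a..t} (\<lambda>x. 2 * Q * v1 x - Q) = u t - u a"
      by (metis integral_unique)
    then show "u t = u a + integral {a..t} (\<lambda>x. 2 * Q * v1 x - Q)" by linarith
  qed
qed

lemma Lipschitz_has_vector_density:
  fixes u :: "real \<Rightarrow> 'a::euclidean_space"
  assumes u: "\<And>s t. s \<in> {a..b} \<Longrightarrow> t \<in> {a..b} \<Longrightarrow> norm (u t - u s) \<le> R * \<bar>t - s\<bar>" and ab: "a \<le> b"
  obtains v where "v absolutely_integrable_on {a..b}"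
    "\<And>t. t \<in> {a..b} \<Longrightarrow> u t = u a + integral {a..t} v"
proof -
  have "\<exists>v. v absolutely_integrable_on {a..b} \<and> (\<forall>t\<in>{a..b}. u t \<bullet> i = u a \<bullet> i + integral {a..t} v)"
    if "i \<in> Basis" for i
  proof -
    have *: "\<bar>u t \<bullet> i - u s \<bullet> i\<bar> \<le> R * \<bar>t - s\<bar>" if "s \<in> {a..b}" "t \<in> {a..b}" for s t
      using Basis_le_norm[OF \<open>i \<in> Basis\<close>, of "u t - u s"] u[OF that] by (simp add: inner_diff_left)
    show ?thesis by (rule Lipschitz_has_density[of a b "\<lambda>t. u t \<bullet> i" R, OF _ ab]) (rule *)
  qed
  then obtain v where v: "\<And>i. i \<in> Basis \<Longrightarrow> v i absolutely_integrable_on {a..b}"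
    "\<And>i t. i \<in> Basis \<Longrightarrow> t \<in> {a..b} \<Longrightarrow> u t \<bullet> i = u a \<bullet> i + integral {a..t} (v i)" by metis
  define w where "w = (\<lambda>t. \<Sum>i\<in>Basis. v i t *\<^sub>R i)"
  have wi: "(\<lambda>t. w t \<bullet> i) = v i" if "i \<in> Basis" for i
    using that by (simp add: w_def fun_eq_iff inner_sum_left_Basis)
  have w: "w absolutely_integrable_on {a..b}"
    by (subst absolutely_integrable_componentwise_iff) (auto simp: wi v(1))
  show thesis
  proof (rule that[OF w])
    fix t assume t: "t \<in> {a..b}"
    have "w integrable_on {a..t}"
      by (rule integrable_on_subinterval[OF set_lebesgue_integral_eq_integral(1)[OF w]]) (use t in auto)
    then have "integral {a..t} w \<bullet> i = integral {a..t} (v i)" if "i \<in> Basis" for i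
      using integral_component_eq[of w "{a..t}" i] unfolding wi[OF that] by simp
    then show "u t = u a + integral {a..t} w"
      using v(2)[OF _ t] by (simp add: euclidean_eq_iff[of "u t"] inner_add_left)
  qed
qed

section \<open>Primitives and their derivatives almost everywhere\<close>

lemma integrable_lebesgue_on_iff:
  fixes f :: "real \<Rightarrow> 'a::euclidean_space"
  shows "integrable (lebesgue_on {a..b}) f \<longleftrightarrow> f absolutely_integrable_on {a..b}"
  by (simp add: integrable_restrict_space set_integrable_def)

lemma AE_lebesgue_on_iff_negligible:
  "(AE t in lebesgue_on {a..b::real}. P t) \<longleftrightarrow> negligible {t\<in>{a..b}. \<not> P t}"
proof -
  have "(AE t in lebesgue_on {a..b::real}. P t) \<longleftrightarrow> (AE t in lebesgue. t \<in> {a..b} \<longrightarrow> P t)"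
    by (intro AE_restrict_space_iff) auto
  also have "\<dots> \<longleftrightarrow> negligible {t\<in>{a..b}. \<not> P t}"
    unfolding negligible_iff_null_sets eventually_ae_filter
    by (auto intro: completion.complete2 null_sets_completionI exI[of _ "{t\<in>{a..b}. \<not> P t}"])
  finally show ?thesis .
qed

text \<open>Holds by completeness of Lebesgue measure. It serves \<open>dot u\<close>, whose values
  are unspecified where \<open>u\<close> is not differentiable.\<close>

lemma borel_measurable_lebesgue_on_AE:
  fixes f g :: "real \<Rightarrow> 'a::euclidean_space"
  assumes "f \<in> borel_measurable (lebesgue_on {a..b})" "AE t in lebesgue_on {a..b}. g t = f t"
  shows "g \<in> borel_measurable (lebesgue_on {a..b})"
proof -
  have S: "{a..b} \<in> sets lebesgue" by simp
  have "g measurable_on {a..b}"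
  proof (rule measurable_on_spike)
    show "f measurable_on {a..b}" using assms(1) by (subst measurable_on_iff_borel_measurable[OF S])
    show "negligible {t\<in>{a..b}. g t \<noteq> f t}" using assms(2) by (subst (asm) AE_lebesgue_on_iff_negligible)
  qed auto
  then show ?thesis by (subst (asm) measurable_on_iff_borel_measurable[OF S])
qed

text \<open>Since \<open>u\<close> is prescribed on \<open>{a..b}\<close> only, nothing is known
  about a two-sided derivative at the end points; they are added to the null set where the
  indefinite integral fails to be differentiable.\<close>

lemma
  fixes u v :: "real \<Rightarrow> 'a::euclidean_space"
  assumes v: "v absolutely_integrable_on {a..b}"
    and u: "\<And>t. t \<in> {a..b} \<Longrightarrow> u t = c + integral {a..t} v"
  shows primitive_abs_continuous_on: "abs_continuous_on a b u"
    and primitive_AE_has_vector_derivative: "AE t in lebesgue_on {a..b}. (u has_vector_derivative v t) (at t)"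
    and primitive_dot_measurable: "dot u \<in> borel_measurable (lebesgue_on {a..b})"
    and primitive_AE_dot_eq: "AE t in lebesgue_on {a..b}. dot u t = v t"
proof -
  show "abs_continuous_on a b u"
    unfolding abs_continuous_on_def
  proof (intro allI impI)
    fix \<epsilon> :: real assume "\<epsilon> > 0"
    then obtain \<delta> where \<delta>: "\<delta> > 0" "\<And>P. finite P \<and> (\<forall>(s, t)\<in>P. a \<le> s \<and> s \<le> t \<and> t \<le> b) \<and>
        disjoint_family_on (\<lambda>(s, t). {s<..<t}) P \<and> (\<Sum>(s, t)\<in>P. t - s) < \<delta> \<Longrightarrow>
        (\<Sum>(s, t)\<in>P. norm ((c + integral {a..t} v) - (c + integral {a..s} v))) < \<epsilon>"
      using abs_continuous_on_indefinite_integral[OF v, of c] unfolding abs_continuous_on_def by blast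
    have "(\<Sum>(s, t)\<in>P. norm (u t - u s)) =
        (\<Sum>(s, t)\<in>P. norm ((c + integral {a..t} v) - (c + integral {a..s} v)))"
      if "\<forall>(s, t)\<in>P. a \<le> s \<and> s \<le> t \<and> t \<le> b" for P
      using that u by (intro sum.cong refl) (force split: prod.splits)
    then show "\<exists>\<delta>>0. \<forall>P. finite P \<and> (\<forall>(s, t)\<in>P. a \<le> s \<and> s \<le> t \<and> t \<le> b) \<and>
        disjoint_family_on (\<lambda>(s, t). {s<..<t}) P \<and> (\<Sum>(s, t)\<in>P. t - s) < \<delta> \<longrightarrow>
        (\<Sum>(s, t)\<in>P. norm (u t - u s)) < \<epsilon>"
      using \<delta> by (intro exI[of _ \<delta>]) simp
  qed
  have "v integrable_on {a..b}" using v set_lebesgue_integral_eq_integral(1) by blast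
  from negligible_indefinite_integral_not_differentiable[OF this]
  have "negligible ({a, b} \<union> {x\<in>{a..b}. \<not> ((\<lambda>t. integral {a..t} v) has_vector_derivative v x) (at x)})"
    by (intro negligible_Un) auto
  moreover have "(u has_vector_derivative v t) (at t)"
    if t: "t \<in> {a<..<b}" "((\<lambda>t. integral {a..t} v) has_vector_derivative v t) (at t)" for t
  proof -
    have "((\<lambda>t. c + integral {a..t} v) has_vector_derivative (0 + v t)) (at t)"
      using t(2) by (intro has_vector_derivative_add has_vector_derivative_const)
    then have "((\<lambda>t. c + integral {a..t} v) has_vector_derivative v t) (at t)" by simp
    then show ?thesis
      by (rule has_vector_derivative_transform_within_open[of _ _ _ "{a<..<b}"]) (use t u in auto)
  qed
  ultimately show AE: "AE t in lebesgue_on {a..b}. (u has_vector_derivative v t) (at t)"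
    unfolding AE_lebesgue_on_iff_negligible
    by (elim negligible_subset) (auto simp: less_le)
  then show eq: "AE t in lebesgue_on {a..b}. dot u t = v t"
    by eventually_elim (rule vector_derivative_at)
  have "v \<in> borel_measurable (lebesgue_on {a..b})"
    using v by (intro borel_measurable_integrable) (simp add: integrable_lebesgue_on_iff)
  then show "dot u \<in> borel_measurable (lebesgue_on {a..b})"
    by (rule borel_measurable_lebesgue_on_AE[OF _ eq])
qed

lemma abs_continuous_on_imp_continuous_on:
  fixes u :: "real \<Rightarrow> 'a::real_normed_vector"
  assumes "abs_continuous_on a b u"
  shows "continuous_on {a..b} u"
proof (rule continuous_onI)
  fix s \<epsilon> :: real assume s: "s \<in> {a..b}" and "\<epsilon> > 0"
  with assms obtain \<delta> where \<delta>: "\<delta> > 0" "\<And>P. finite P \<and> (\<forall>(s, t)\<in>P. a \<le> s \<and> s \<le> t \<and> t \<le> b) \<and>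
      disjoint_family_on (\<lambda>(s, t). {s<..<t}) P \<and> (\<Sum>(s, t)\<in>P. t - s) < \<delta> \<Longrightarrow>
      (\<Sum>(s, t)\<in>P. norm (u t - u s)) < \<epsilon>"
    unfolding abs_continuous_on_def by blast
  have *: "norm (u y - u x) < \<epsilon>" if "a \<le> x" "x \<le> y" "y \<le> b" "y - x < \<delta>" for x y
    using \<delta>(2)[of "{(x, y)}"] that by (auto simp: disjoint_family_on_def)
  have "dist (u t) (u s) \<le> \<epsilon>" if "t \<in> {a..b}" "dist t s < \<delta>" for t
    using *[of s t] *[of t s] that s by (cases "s \<le> t") (auto simp: dist_norm norm_minus_commute)
  then show "\<exists>\<delta>>0. \<forall>t\<in>{a..b}. dist t s < \<delta> \<longrightarrow> dist (u t) (u s) \<le> \<epsilon>" using \<delta>(1) by blast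
qed

section \<open>G-functions\<close>

lemma G_function_continuous:
  assumes "G_function G" shows "continuous_on UNIV G"
  using assms by (auto simp: G_function_def intro: convex_on_continuous)

lemma G_function_superlinear:
  fixes G :: "'a::euclidean_space \<Rightarrow> real"
  assumes "G_function G"
  obtains r where "r > 0" "\<And>x. norm x \<ge> r \<Longrightarrow> G x \<ge> Z * norm x"
proof -
  have "eventually (\<lambda>x. Z \<le> G x / norm x) at_infinity"
    using assms by (auto simp: G_function_def filterlim_at_top)
  then obtain b where b: "\<And>x. norm x \<ge> b \<Longrightarrow> Z \<le> G x / norm x"
    by (auto simp: eventually_at_infinity)
  show thesis
  proof
    show "max b 1 > 0" by simp
    fix x :: 'a assume "norm x \<ge> max b 1"
    then have "norm x > 0" "Z \<le> G x / norm x" using b by auto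
    then show "G x \<ge> Z * norm x" by (simp add: pos_le_divide_eq)
  qed
qed

text \<open>Makes the real supremum in \<open>fenchel_conj\<close> meaningful: beyond the radius
  where \<open>G x\<close> exceeds \<open>norm y * norm x\<close> the expression is at most zero,
  and inside it Cauchy-Schwarz applies.\<close>

lemma G_function_bdd_above:
  assumes "G_function G" shows "bdd_above (range (\<lambda>x. x \<bullet> y - G x))"
proof -
  obtain r where r: "r > 0" "\<And>x. norm x \<ge> r \<Longrightarrow> G x \<ge> norm y * norm x"
    using G_function_superlinear[OF assms] by blast
  have "x \<bullet> y - G x \<le> r * norm y" for x
  proof (cases "norm x \<ge> r")
    case True
    have "x \<bullet> y \<le> norm y * norm x" using norm_cauchy_schwarz[of x y] by (simp add: mult.commute)
    also have "\<dots> \<le> G x" using r True by auto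
    finally have "x \<bullet> y - G x \<le> 0" by simp
    also have "0 \<le> r * norm y" using r by simp
    finally show ?thesis .
  next
    case False
    have "x \<bullet> y \<le> norm x * norm y" by (rule norm_cauchy_schwarz)
    also have "\<dots> \<le> r * norm y" using False by (intro mult_right_mono) auto
    finally have "x \<bullet> y \<le> r * norm y" .
    moreover have "0 \<le> G x" using assms by (simp add: G_function_def)
    ultimately show ?thesis by linarith
  qed
  then show ?thesis by (intro bdd_aboveI2)
qed

lemma fenchel_young:
  assumes "G_function G" shows "x \<bullet> y \<le> G x + fenchel_conj G y"
proof -
  have "x \<bullet> y - G x \<le> fenchel_conj G y"
    unfolding fenchel_conj_def by (rule cSUP_upper[OF UNIV_I G_function_bdd_above[OF assms]])
  then show ?thesis by simp
qed

lemma fenchel_conj_nonneg: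
  assumes "G_function G" shows "0 \<le> fenchel_conj G y"
  using fenchel_young[OF assms, of 0 y] assms by (simp add: G_function_def)

text \<open>A finite supremum of affine functions is convex, and a convex function that is finite on
  the whole space is continuous. Needed for the measurability of \<open>fenchel_conj G (f t)\<close>
  in \<open>t\<close>.\<close>

lemma fenchel_conj_continuous:
  assumes "G_function G" shows "continuous_on UNIV (fenchel_conj G)"
proof (rule convex_on_continuous)
  show "convex_on UNIV (fenchel_conj G)"
  proof (rule convex_onI)
    fix t :: real and y z :: 'a assume t: "0 < t" "t < 1"
    have "x \<bullet> ((1 - t) *\<^sub>R y + t *\<^sub>R z) - G x \<le> (1 - t) * fenchel_conj G y + t * fenchel_conj G z" for x
    proof -
      have "(1 - t) * (x \<bullet> y - G x) + t * (x \<bullet> z - G x) \<le> (1 - t) * fenchel_conj G y + t * fenchel_conj G z"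
        using fenchel_young[OF assms, of x y] fenchel_young[OF assms, of x z] t
        by (intro add_mono mult_left_mono) auto
      then show ?thesis by (simp add: inner_add_right algebra_simps)
    qed
    then show "fenchel_conj G ((1 - t) *\<^sub>R y + t *\<^sub>R z) \<le> (1 - t) * fenchel_conj G y + t * fenchel_conj G z"
      unfolding fenchel_conj_def[of G "(1 - t) *\<^sub>R y + t *\<^sub>R z"] by (intro cSUP_least) auto
  qed simp
qed simp

text \<open>The second claim tests the Fenchel-Young inequality with \<open>sgn (f t)\<close>:
  \<open>norm (f t)\<close> is at most \<open>fenchel_conj G (f t)\<close> plus a bound of
  \<open>G\<close> on the unit ball.\<close>

lemma orlicz_fenchel_conj_integrable:
  fixes G :: "'a::euclidean_space \<Rightarrow> real"
  assumes G: "G_function G" and f: "f \<in> orlicz T (fenchel_conj G)"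
  shows "(\<lambda>t. fenchel_conj G (f t)) absolutely_integrable_on {-T..T}" "f absolutely_integrable_on {-T..T}"
proof -
  let ?M = "lebesgue_on {-T..T}"
  have fm: "f \<in> borel_measurable ?M" and fin: "(\<integral>\<^sup>+t. ennreal (fenchel_conj G (f t)) \<partial>?M) < \<infinity>"
    using f by (auto simp: orlicz_def)
  have "(\<lambda>t. fenchel_conj G (f t)) \<in> borel_measurable ?M"
    using measurable_compose[OF fm borel_measurable_continuous_onI[OF fenchel_conj_continuous[OF G]]] .
  then have i: "integrable ?M (\<lambda>t. fenchel_conj G (f t))"
    using fin fenchel_conj_nonneg[OF G] by (intro integrableI_nonneg) auto
  then show "(\<lambda>t. fenchel_conj G (f t)) absolutely_integrable_on {-T..T}"
    by (simp add: integrable_lebesgue_on_iff)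
  obtain S where S: "\<And>x. norm x \<le> 1 \<Longrightarrow> G x \<le> S"
  proof -
    have "bounded (G ` cball 0 1)"
      by (intro compact_imp_bounded compact_continuous_image continuous_on_subset[OF G_function_continuous[OF G]]) auto
    then obtain S where "\<forall>y\<in>G ` cball 0 1. norm y \<le> S" by (auto simp: bounded_iff)
    then show thesis by (intro that[of S]) (force simp: abs_le_iff)
  qed
  have "norm (f t) \<le> fenchel_conj G (f t) + S" for t
  proof -
    have "sgn (f t) \<bullet> f t = norm (f t)"
      by (cases "f t = 0") (simp_all add: sgn_div_norm dot_square_norm power2_eq_square)
    moreover have "G (sgn (f t)) \<le> S" by (rule S) (simp add: norm_sgn)
    ultimately show ?thesis using fenchel_young[OF G, of "sgn (f t)" "f t"] by linarith
  qed
  note bound = this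
  have "integrable ?M (\<lambda>t. S)" by (simp add: integrable_lebesgue_on_iff absolutely_integrable_on_const)
  then have "integrable ?M (\<lambda>t. fenchel_conj G (f t) + S)"
    using i by (rule Bochner_Integration.integrable_add[rotated])
  then have "integrable ?M f"
    using fm by (rule Bochner_Integration.integrable_bound) (intro AE_I2, use bound in \<open>force intro: order_trans[OF _ abs_ge_self]\<close>)
  then show "f absolutely_integrable_on {-T..T}" by (simp add: integrable_lebesgue_on_iff)
qed

text \<open>Convexity and \<open>G 0 = 0\<close> give \<open>G (x / c) \<le> G x / c\<close> for
  \<open>c \<ge> 1\<close>, so \<open>max 1 (modular T G u)\<close> is an admissible scaling in the
  infimum.\<close>

lemma luxemburg_norm_le:
  assumes G: "G_function G" and i: "integrable (lebesgue_on {-T..T}) (\<lambda>t. G (u t))"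
  shows "luxemburg_norm T G u \<le> max 1 (modular T G u)"
proof -
  let ?M = "lebesgue_on {-T..T}"
  define c where "c = max 1 (modular T G u)"
  have c: "c \<ge> 1" "modular T G u \<le> c" by (auto simp: c_def)
  have le: "G (x /\<^sub>R c) \<le> G x / c" for x
  proof -
    have "G ((1 - 1/c) *\<^sub>R 0 + (1/c) *\<^sub>R x) \<le> (1 - 1/c) * G 0 + (1/c) * G x"
      using G c by (intro convex_onD[of UNIV G]) (auto simp: G_function_def)
    then show ?thesis using G by (simp add: G_function_def divide_inverse mult.commute)
  qed
  have "(\<integral>\<^sup>+t. ennreal (G (u t /\<^sub>R c)) \<partial>?M) \<le> (\<integral>\<^sup>+t. ennreal (G (u t) / c) \<partial>?M)"
    by (intro nn_integral_mono ennreal_leI le)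
  also have "\<dots> = ennreal (\<integral>t. G (u t) / c \<partial>?M)"
    using i G c by (intro nn_integral_eq_integral) (auto simp: G_function_def)
  also have "(\<integral>t. G (u t) / c \<partial>?M) = modular T G u / c" by (simp add: modular_def)
  also have "ennreal (modular T G u / c) \<le> 1"
    using c by (simp add: ennreal_le_1)
  finally have "(\<integral>\<^sup>+t. ennreal (G (u t /\<^sub>R c)) \<partial>?M) \<le> 1" .
  then show ?thesis
    unfolding luxemburg_norm_def c_def[symmetric]
    using c by (intro cInf_lower bdd_belowI[of _ 0]) auto
qed

text \<open>The factor \<open>2\<close> counts the two Luxemburg norms, of \<open>u\<close> and of
  \<open>dot u\<close>, each at most \<open>r\<close> because \<open>r \<ge> 1\<close>. The
  essential bound becomes a bound at every point because \<open>u\<close> is continuous.\<close>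

lemma embedding_constant_bound:
  fixes G :: "'a::euclidean_space \<Rightarrow> real"
  assumes G: "G_function G" and C: "embedding_constant T G C" and T: "T > 0"
    and u: "u \<in> orlicz_sobolev T G" and r: "modular T G u + modular T G (dot u) \<le> r" "r \<ge> 1"
    and t: "t \<in> {-T..T}"
  shows "norm (u t) \<le> C * (2 * r)"
proof -
  let ?M = "lebesgue_on {-T..T}"
  have Gm: "G \<in> borel_measurable borel"
    by (intro borel_measurable_continuous_onI G_function_continuous[OF G])
  have i: "w \<in> borel_measurable ?M \<and> integrable ?M (\<lambda>t. G (w t))" if "w \<in> orlicz T G" for w
    using that G measurable_compose[OF _ Gm, of w ?M]
    by (auto simp: orlicz_def G_function_def intro!: integrableI_nonneg)
  have nn: "0 \<le> modular T G w" for w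
    unfolding modular_def using G by (intro Bochner_Integration.integral_nonneg) (auto simp: G_function_def)
  have uW: "u \<in> orlicz T G" "dot u \<in> orlicz T G" "abs_continuous_on (-T) T u"
    using u by (auto simp: orlicz_sobolev_def)
  have "orlicz_sobolev_norm T G u \<le> max 1 (modular T G u) + max 1 (modular T G (dot u))"
    unfolding orlicz_sobolev_norm_def using i uW by (intro add_mono luxemburg_norm_le G) auto
  also have "\<dots> \<le> 2 * r" using r nn[of u] nn[of "dot u"] by linarith
  finally have "C * orlicz_sobolev_norm T G u \<le> C * (2 * r)"
    using C by (intro mult_left_mono) (auto simp: embedding_constant_def)
  moreover have "esssup ?M (\<lambda>t. ereal (norm (u t))) \<le> ereal (C * orlicz_sobolev_norm T G u)"
    using C u by (auto simp: embedding_constant_def)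
  ultimately have es: "esssup ?M (\<lambda>t. ereal (norm (u t))) \<le> ereal (C * (2 * r))"
    by (meson ereal_less_eq(3) order_trans)
  have "AE t in ?M. norm (u t) \<le> C * (2 * r)"
    using esssup_AE[of "\<lambda>t. ereal (norm (u t))" ?M]
  proof eventually_elim
    case (elim t)
    then have "ereal (norm (u t)) \<le> ereal (C * (2 * r))" using es order_trans by blast
    then show ?case by simp
  qed
  then have AE: "AE t in lebesgue. t \<in> {-T..T} \<longrightarrow> norm (u t) \<le> C * (2 * r)"
    by (subst (asm) AE_restrict_space_iff) auto
  define D where "D = {t\<in>{-T..T}. norm (u t) \<le> C * (2 * r)}"
  have cont: "continuous_on {-T..T} u" using abs_continuous_on_imp_continuous_on uW by blast
  have D: "closed D"
    unfolding D_def
    by (intro continuous_on_closed_Collect_le continuous_intros cont)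
  have "s \<in> D" if "s \<in> {-T<..<T}" for s
  proof (rule mem_closed_if_AE_lebesgue_open[OF _ D _ that])
    show "AE x\<in>{-T<..<T} in lebesgue. x \<in> D"
      using AE by eventually_elim (auto simp: D_def)
  qed auto
  then have "closure {-T<..<T} \<subseteq> D" using D by (intro closure_minimal) auto
  then have "{-T..T} \<subseteq> D" using T by (simp add: closure_greaterThanLessThan)
  then show ?thesis using t by (auto simp: D_def)
qed

section \<open>Piecewise linear interpolation on a grid\<close>

locale grid =
  fixes T h :: real and m :: nat
  assumes T: "T > 0" and m: "m > 0" and h: "h = 2 * T / real m"
begin

definition node :: "nat \<Rightarrow> real" where "node i = - T + real i * h"

text \<open>The last cell is closed on the right.\<close>
definition cell :: "real \<Rightarrow> nat" where "cell t = min (m - 1) (nat \<lfloor>(t + T) / h\<rfloor>)"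

definition slope :: "(nat \<Rightarrow> 'a::real_vector) \<Rightarrow> nat \<Rightarrow> 'a" where
  "slope x j = (x (Suc j) - x j) /\<^sub>R h"

text \<open>Given as a primitive of the step function of slopes, so that absolute continuity and the
  derivative almost everywhere come from the results on primitives; \<open>interp_node\<close>
  confirms the values at the nodes.\<close>

definition interp :: "(nat \<Rightarrow> 'a::euclidean_space) \<Rightarrow> real \<Rightarrow> 'a" where
  "interp x t = x 0 + integral {-T..t} (\<lambda>s. slope x (cell s))"

text \<open>Evaluates \<open>G (x j)\<close> at the left node of each cell. If
  \<open>x 0 = x m\<close>, convexity makes this an upper bound for the sum of the two modulars of
  the interpolant.\<close>

definition energy :: "('a::real_vector \<Rightarrow> real) \<Rightarrow> (nat \<Rightarrow> 'a) \<Rightarrow> real" where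
  "energy G x = (\<Sum>j<m. h * (G (slope x j) + G (x j)))"

lemma h_pos: "h > 0" using T m h by simp

lemma node_0 [simp]: "node 0 = - T" by (simp add: node_def)

lemma node_m [simp]: "node m = T"
proof -
  have "real m * h = 2 * T" using m by (simp add: h)
  then show ?thesis by (simp add: node_def)
qed

lemma node_Suc: "node (Suc i) = node i + h" by (simp add: node_def algebra_simps)

lemma node_mono: "i \<le> j \<Longrightarrow> node i \<le> node j" using h_pos by (simp add: node_def)

lemma node_bounds: "i \<le> m \<Longrightarrow> node i \<in> {-T..T}"
  using node_mono[of 0 i] node_mono[of i m] by simp

lemma cell_less: "cell t < m" unfolding cell_def using m by linarith

lemma cell_eq:
  assumes "i < m" "node i \<le> t" "t < node (Suc i)" shows "cell t = i"
proof -
  have "real i \<le> (t + T) / h" "(t + T) / h < real i + 1"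
    using assms h_pos by (simp_all add: node_def field_simps)
  then have "\<lfloor>(t + T) / h\<rfloor> = int i" by (intro floor_unique) auto
  then show ?thesis using assms(1) by (simp add: cell_def)
qed

lemma cell_bounds:
  assumes "t \<in> {-T..T}" shows "node (cell t) \<le> t" "t \<le> node (Suc (cell t))"
proof -
  define i where "i = nat \<lfloor>(t + T) / h\<rfloor>"
  have nn: "0 \<le> (t + T) / h" using assms h_pos by simp
  then have fl: "real i \<le> (t + T) / h" "(t + T) / h < real i + 1"
    unfolding i_def by linarith+
  then have i: "node i \<le> t" "t < node (Suc i)"
    using h_pos by (simp_all add: node_def field_simps)
  show "node (cell t) \<le> t" "t \<le> node (Suc (cell t))"
  proof -
    show "node (cell t) \<le> t" 
      using node_mono[of "cell t" i] i by (simp add: cell_def i_def)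
    show "t \<le> node (Suc (cell t))"
    proof (cases "i < m")
      case True
      then have "cell t = i" by (simp add: cell_def i_def)
      then show ?thesis using i by simp
    next
      case False
      then have "Suc (cell t) = m" using m by (simp add: cell_def i_def)
      then show ?thesis using assms by simp
    qed
  qed
qed

text \<open>An inner node is assigned to the cell on its right, so on each closed cell the integrand
  agrees with \<open>g j\<close> except possibly at the right end; a single point does not affect
  the integral.\<close>

lemma has_integral_cells:
  fixes g :: "nat \<Rightarrow> real \<Rightarrow> 'b::euclidean_space"
  assumes "n \<le> m" "\<And>j. j < n \<Longrightarrow> (g j has_integral I j) {node j..node (Suc j)}"
  shows "((\<lambda>t. g (cell t) t) has_integral (\<Sum>j<n. I j)) {-T..node n}"
  using assms
proof (induction n)
  case 0
  then show ?case using has_integral_null_real[of "-T" "-T"] by simp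
next
  case (Suc n)
  have "((\<lambda>t. g (cell t) t) has_integral I n) {node n..node (Suc n)}"
  proof (rule has_integral_spike_finite)
    show "(g n has_integral I n) {node n..node (Suc n)}" using Suc by simp
    show "g (cell t) t = g n t" if "t \<in> {node n..node (Suc n)} - {node (Suc n)}" for t
      using cell_eq[of n t] that Suc.prems(1) by auto
  qed simp
  moreover have "((\<lambda>t. g (cell t) t) has_integral (\<Sum>j<n. I j)) {-T..node n}"
    using Suc by simp
  ultimately show ?case
    using has_integral_combine[of "-T" "node n" "node (Suc n)" "\<lambda>t. g (cell t) t"]
      node_mono[of 0 n] node_mono[of n "Suc n"] by simp
qed

lemma has_integral_step:
  fixes d :: "nat \<Rightarrow> 'b::euclidean_space"
  shows "((\<lambda>t. d (cell t)) has_integral (\<Sum>j<m. h *\<^sub>R d j)) {-T..T}"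
proof -
  have "((\<lambda>t. d (cell t)) has_integral (\<Sum>j<m. h *\<^sub>R d j)) {-T..node m}"
  proof (rule has_integral_cells[OF order_refl])
    show "((\<lambda>_. d j) has_integral h *\<^sub>R d j) {node j..node (Suc j)}" for j
      using has_integral_const_real[of "d j" "node j" "node (Suc j)"] h_pos by (simp add: node_Suc)
  qed
  then show ?thesis by simp
qed

lemma step_absolutely_integrable:
  fixes d :: "nat \<Rightarrow> 'b::euclidean_space"
  shows "(\<lambda>t. d (cell t)) absolutely_integrable_on {-T..T}"
  using has_integral_step[of d] has_integral_step[of "\<lambda>j. norm (d j)"]
  by (intro absolutely_integrable_onI) (auto simp: integrable_on_def)

lemma step_integrable:
  fixes d :: "nat \<Rightarrow> 'b::euclidean_space"
  assumes "-T \<le> a" "b \<le> T"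
  shows "(\<lambda>t. d (cell t)) integrable_on {a..b}"
  by (rule integrable_on_subinterval[of _ "{-T..T}"]) (use has_integral_step[of d] assms in \<open>auto simp: integrable_on_def\<close>)

lemma interp_diff:
  assumes "-T \<le> s" "s \<le> t" "t \<le> T"
  shows "interp x t - interp x s = integral {s..t} (\<lambda>r. slope x (cell r))"
proof -
  have "integral {-T..s} (\<lambda>r. slope x (cell r)) + integral {s..t} (\<lambda>r. slope x (cell r))
      = integral {-T..t} (\<lambda>r. slope x (cell r))"
    using assms by (intro Henstock_Kurzweil_Integration.integral_combine step_integrable) auto
  then show ?thesis by (simp add: interp_def algebra_simps)
qed

lemma interp_cell:
  assumes "i < m" "t \<in> {node i..node (Suc i)}"
  shows "interp x t = interp x (node i) + (t - node i) *\<^sub>R slope x i"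
proof -
  have "((\<lambda>r. slope x (cell r)) has_integral (t - node i) *\<^sub>R slope x i) {node i..t}"
  proof (rule has_integral_spike_finite)
    show "((\<lambda>r. slope x i) has_integral (t - node i) *\<^sub>R slope x i) {node i..t}"
      using has_integral_const_real[of "slope x i" "node i" t] assms by simp
    show "slope x (cell r) = slope x i" if "r \<in> {node i..t} - {node (Suc i)}" for r
      using cell_eq[of i r] that assms by auto
  qed simp
  then have "integral {node i..t} (\<lambda>r. slope x (cell r)) = (t - node i) *\<^sub>R slope x i"
    by (rule integral_unique)
  moreover have "-T \<le> node i" "node i \<le> t" "t \<le> T"
    using node_bounds[of i] node_bounds[of "Suc i"] assms by auto
  ultimately show ?thesis using interp_diff[of "node i" t x] by (simp add: algebra_simps)
qed

lemma interp_node: "i \<le> m \<Longrightarrow> interp x (node i) = x i"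
proof (induction i)
  case (Suc i)
  then have "interp x (node (Suc i)) = x i + h *\<^sub>R slope x i"
    using interp_cell[of i "node (Suc i)" x] h_pos by (simp add: node_Suc)
  then show ?case using h_pos by (simp add: slope_def)
qed (simp add: interp_def)

lemma G_interp_le:
  assumes G: "convex_on UNIV G" and i: "i < m" and t: "t \<in> {node i..node (Suc i)}"
  shows "G (interp x t) \<le> G (x i) + (t - node i) * ((G (x (Suc i)) - G (x i)) / h)"
proof -
  define \<theta> where "\<theta> = (t - node i) / h"
  have \<theta>: "0 \<le> \<theta>" "\<theta> \<le> 1" using t h_pos by (auto simp: \<theta>_def node_Suc)
  have "interp x t = (1 - \<theta>) *\<^sub>R x i + \<theta> *\<^sub>R x (Suc i)"
    unfolding interp_cell[OF i t] interp_node[OF less_imp_le[OF i]]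
    by (simp add: slope_def \<theta>_def divide_inverse algebra_simps)
  then have "G (interp x t) \<le> (1 - \<theta>) * G (x i) + \<theta> * G (x (Suc i))"
    using convex_onD[OF G \<theta>] by simp
  also have "\<dots> = G (x i) + (t - node i) * ((G (x (Suc i)) - G (x i)) / h)"
    by (simp add: \<theta>_def field_simps diff_divide_distrib)
  finally show ?thesis .
qed

text \<open>By convexity, \<open>G\<close> along the interpolant lies below its chord on each cell,
  whose integral is the trapezoidal value; \<open>x 0 = x m\<close> turns the trapezoidal sum into
  the left-node sum of \<open>energy\<close>.\<close>

lemma interp_orlicz_sobolev:
  fixes G :: "'a::euclidean_space \<Rightarrow> real"
  assumes G: "G_function G" and x: "x 0 = x m"
  shows "interp x \<in> orlicz_sobolev T G"
    and "modular T G (interp x) + modular T G (dot (interp x)) \<le> energy G x"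
proof -
  let ?M = "lebesgue_on {-T..T}"
  note pr = step_absolutely_integrable[of "slope x"] interp_def[of x]
  have ac: "abs_continuous_on (-T) T (interp x)" by (rule primitive_abs_continuous_on[OF pr])
  then have cont: "continuous_on {-T..T} (interp x)" by (rule abs_continuous_on_imp_continuous_on)
  have dm: "dot (interp x) \<in> borel_measurable ?M" by (rule primitive_dot_measurable[OF pr])
  have de: "AE t in ?M. dot (interp x) t = slope x (cell t)" by (rule primitive_AE_dot_eq[OF pr])
  have Gc: "continuous_on UNIV G" by (rule G_function_continuous[OF G])
  have Gnn: "0 \<le> G y" for y using G by (simp add: G_function_def)
  have si: "integrable ?M (\<lambda>t. G (slope x (cell t)))"
    using step_absolutely_integrable[of "\<lambda>j. G (slope x j)"] by (simp add: integrable_lebesgue_on_iff)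
  have Gdm: "(\<lambda>t. G (dot (interp x) t)) \<in> borel_measurable ?M"
    using measurable_compose[OF dm borel_measurable_continuous_onI[OF Gc]] .
  have ae: "AE t in ?M. G (slope x (cell t)) = G (dot (interp x) t)"
    using de by eventually_elim simp
  have Gd: "integrable ?M (\<lambda>t. G (dot (interp x) t))"
    using si Gdm ae by (rule integrable_cong_AE_imp)
  have d2: "modular T G (dot (interp x)) = (\<Sum>j<m. h * G (slope x j))"
  proof -
    have "modular T G (dot (interp x)) = integral\<^sup>L ?M (\<lambda>t. G (slope x (cell t)))"
      unfolding modular_def using si Gdm ae by (intro integral_cong_AE) auto
    also have "\<dots> = integral {-T..T} (\<lambda>t. G (slope x (cell t)))"
      using si by (intro lebesgue_integral_eq_integral) auto
    also have "\<dots> = (\<Sum>j<m. h * G (slope x j))"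
      using has_integral_step[of "\<lambda>j. G (slope x j)"] by (simp add: integral_unique)
    finally show ?thesis .
  qed
  have Gu: "continuous_on {-T..T} (\<lambda>t. G (interp x t))"
    using continuous_on_compose2[OF Gc cont] by simp
  then have Gua: "(\<lambda>t. G (interp x t)) absolutely_integrable_on {-T..T}"
    by (intro nonnegative_absolutely_integrable_1 integrable_continuous_real Gnn)
  then have Gui: "integrable ?M (\<lambda>t. G (interp x t))" by (simp add: integrable_lebesgue_on_iff)
  have um: "interp x \<in> borel_measurable ?M"
    by (rule continuous_imp_measurable_on_sets_lebesgue[OF cont]) simp
  have "modular T G (interp x) = integral {-T..T} (\<lambda>t. G (interp x t))"
    unfolding modular_def using Gui by (intro lebesgue_integral_eq_integral) auto
  also have "\<dots> \<le> (\<Sum>j<m. h * (G (x j) + G (x (Suc j))) / 2)"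
  proof -
    define A where "A = (\<lambda>j t. G (x j) + (t - node j) * ((G (x (Suc j)) - G (x j)) / h))"
    have "(A j has_integral h * (G (x j) + G (x (Suc j))) / 2) {node j..node (Suc j)}" for j
    proof -
      define B where "B = (G (x (Suc j)) - G (x j)) / h"
      \<comment> \<open>An antiderivative of the chord \<open>A j\<close>.\<close>
      define F where "F = (\<lambda>t. G (x j) * t + (t - node j)^2 / 2 * B)"
      have "(A j has_integral F (node (Suc j)) - F (node j)) {node j..node (Suc j)}"
      proof (rule fundamental_theorem_of_calculus)
        show "node j \<le> node (Suc j)" by (rule node_mono) simp
        fix t
        show "(F has_vector_derivative A j t) (at t within {node j..node (Suc j)})"
          unfolding has_real_derivative_iff_has_vector_derivative[symmetric] F_def A_def B_def[symmetric]
          by (rule derivative_eq_intros refl | simp)+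
      qed
      moreover have "F (node (Suc j)) - F (node j) = h * (G (x j) + G (x (Suc j))) / 2"
        using h_pos by (simp add: F_def B_def node_Suc field_simps power2_eq_square)
      ultimately show ?thesis by simp
    qed
    then have "((\<lambda>t. A (cell t) t) has_integral (\<Sum>j<m. h * (G (x j) + G (x (Suc j))) / 2)) {-T..node m}"
      by (intro has_integral_cells) auto
    then have "((\<lambda>t. A (cell t) t) has_integral (\<Sum>j<m. h * (G (x j) + G (x (Suc j))) / 2)) {-T..T}"
      by simp
    moreover have "G (interp x t) \<le> A (cell t) t" if "t \<in> {-T..T}" for t
      unfolding A_def using cell_bounds[OF that] cell_less[of t] G
      by (intro G_interp_le) (auto simp: G_function_def)
    moreover have "((\<lambda>t. G (interp x t)) has_integral integral {-T..T} (\<lambda>t. G (interp x t))) {-T..T}"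
      by (intro integrable_integral integrable_continuous_real Gu)
    ultimately show ?thesis by (meson has_integral_le)
  qed
  also have "\<dots> = (\<Sum>j<m. h * G (x j))"
  proof -
    have "(\<Sum>j<m. G (x (Suc j)) - G (x j)) = G (x m) - G (x 0)" by (rule sum_lessThan_telescope)
    then have "(\<Sum>j<m. G (x (Suc j))) = (\<Sum>j<m. G (x j))" using x by (simp add: sum_subtractf)
    then show ?thesis
      by (simp add: sum_divide_distrib[symmetric] sum_distrib_left[symmetric] sum.distrib)
  qed
  finally show "modular T G (interp x) + modular T G (dot (interp x)) \<le> energy G x"
    by (simp add: d2 energy_def sum.distrib distrib_left)
  have "interp x (-T) = interp x T" using interp_node[of 0 x] interp_node[of m x] x by simp
  then show "interp x \<in> orlicz_sobolev T G"
    using ac dm um Gui Gd Gnn nn_integral_eq_integral[of ?M "\<lambda>t. G (interp x t)"]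
      nn_integral_eq_integral[of ?M "\<lambda>t. G (dot (interp x) t)"]
    by (simp add: orlicz_sobolev_def orlicz_def)
qed

end

section \<open>Discrete minimisers\<close>

lemma GDERIV_along_line:
  assumes "GDERIV F (y::'a::real_inner) :> D"
  shows "((\<lambda>s. F (y + s *\<^sub>R w)) has_real_derivative (w \<bullet> D)) (at 0)"
proof -
  have "((\<lambda>s. y + s *\<^sub>R w) has_derivative (\<lambda>s. s *\<^sub>R w)) (at 0)"
    by (auto intro!: derivative_eq_intros)
  moreover have "(F has_derivative (\<lambda>h. h \<bullet> D)) (at (y + 0 *\<^sub>R w))"
    using assms by (simp add: gderiv_def)
  ultimately have "((\<lambda>s. F (y + s *\<^sub>R w)) has_derivative (\<lambda>s. (s *\<^sub>R w) \<bullet> D)) (at 0)"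
    by (rule has_derivative_compose)
  moreover have "(\<lambda>s. (s *\<^sub>R w) \<bullet> D) = (*) (w \<bullet> D)" by (auto simp: fun_eq_iff)
  ultimately show ?thesis by (simp add: has_field_derivative_def)
qed

text \<open>Instantiated with \<open>r = \<rho> / 2\<close>, \<open>\<beta> = b - 1\<close> and
  \<open>\<alpha> t = a t + fenchel_conj G (f t)\<close>. Thus \<open>lower\<close> is
  \<open>A3\<close> with the forcing absorbed by Fenchel-Young, and \<open>embed\<close> is the
  embedding with its norms replaced by modulars.\<close>

locale action =
  fixes T \<rho>\<^sub>0 r \<beta> :: real and G :: "'a::euclidean_space \<Rightarrow> real" and g :: "'a \<Rightarrow> 'a"
    and V :: "real \<Rightarrow> 'a \<Rightarrow> real" and V\<^sub>x :: "real \<Rightarrow> 'a \<Rightarrow> 'a"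
    and \<alpha> :: "real \<Rightarrow> real" and f :: "real \<Rightarrow> 'a"
  assumes T_pos: "T > 0"
    and G: "G_function G" and G_grad: "\<And>x. GDERIV G x :> g x" and g_cont: "continuous_on UNIV g"
    and V_cont: "continuous_on ({-T..T} \<times> UNIV) (\<lambda>(t, x). V t x)"
    and V_grad: "\<And>t x. t \<in> {-T..T} \<Longrightarrow> GDERIV (V t) x :> V\<^sub>x t x"
    and Vx_cont: "continuous_on ({-T..T} \<times> UNIV) (\<lambda>(t, x). V\<^sub>x t x)"
    and f: "f absolutely_integrable_on {-T..T}"
    and \<alpha>: "\<alpha> integrable_on {-T..T}"
    and lower: "\<And>t x. t \<in> {-T..T} \<Longrightarrow> norm x \<le> \<rho>\<^sub>0 \<Longrightarrow> \<beta> * G x - \<alpha> t \<le> V t x + f t \<bullet> x"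
    and \<beta>: "\<beta> > 0" and small: "integral {-T..T} \<alpha> < min 1 \<beta> * r"
    and V_0: "integral {-T..T} (\<lambda>t. V t 0) = 0"
    and embed: "\<And>u t. u \<in> orlicz_sobolev T G \<Longrightarrow> modular T G u + modular T G (dot u) \<le> r \<Longrightarrow>
      t \<in> {-T..T} \<Longrightarrow> norm (u t) \<le> \<rho>\<^sub>0"
    and r_pos: "r > 0" and \<rho>\<^sub>0_nonneg: "\<rho>\<^sub>0 \<ge> 0"
begin

lemma G_nonneg: "0 \<le> G x" and G_0: "G 0 = 0" and G_convex: "convex_on UNIV G"
  using G by (auto simp: G_function_def)

lemma f_integrable: "{c..d} \<subseteq> {-T..T} \<Longrightarrow> f integrable_on {c..d}"
  using f set_lebesgue_integral_eq_integral(1) integrable_on_subinterval by blast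

lemma V_continuous: "continuous_on {-T..T} u \<Longrightarrow> continuous_on {-T..T} (\<lambda>t. V t (u t))"
  using continuous_on_compose2[OF V_cont, of "{-T..T}" "\<lambda>t. (t, u t)"]
  by (simp add: continuous_on_Pair continuous_on_id image_subset_iff)

lemma Vx_continuous: "continuous_on {-T..T} u \<Longrightarrow> continuous_on {-T..T} (\<lambda>t. V\<^sub>x t (u t))"
  using continuous_on_compose2[OF Vx_cont, of "{-T..T}" "\<lambda>t. (t, u t)"]
  by (simp add: continuous_on_Pair continuous_on_id image_subset_iff)

lemma V_integrable: "{c..d} \<subseteq> {-T..T} \<Longrightarrow> (\<lambda>t. V t y) integrable_on {c..d}"
  using continuous_on_subset[OF V_continuous[of "\<lambda>_. y"]]
  by (auto intro!: integrable_continuous_real continuous_intros)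

lemma Vx_integrable: "{c..d} \<subseteq> {-T..T} \<Longrightarrow> (\<lambda>t. V\<^sub>x t y) integrable_on {c..d}"
  using continuous_on_subset[OF Vx_continuous[of "\<lambda>_. y"]]
  by (auto intro!: integrable_continuous_real continuous_intros)

text \<open>The forcing is merely integrable in time, so its term is separated as a linear function
  of \<open>y\<close>; differentiation under the integral is applied to the continuous part
  \<open>V\<close>.\<close>

lemma GDERIV_integral:
  assumes cd: "{c..d} \<subseteq> {-T..T}"
  shows "GDERIV (\<lambda>y. integral {c..d} (\<lambda>t. V t y + f t \<bullet> y)) y :> integral {c..d} (\<lambda>t. V\<^sub>x t y + f t)"
proof -
  have bi: "((\<lambda>y. integral (cbox c d) (\<lambda>t. V t y)) has_derivative
      integral (cbox c d) (\<lambda>t. blinfun_inner_left (V\<^sub>x t y))) (at y within UNIV)"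
  proof (rule leibniz_rule[where fx = "\<lambda>y t. blinfun_inner_left (V\<^sub>x t y)"])
    show "((\<lambda>y. V t y) has_derivative blinfun_apply (blinfun_inner_left (V\<^sub>x t y))) (at y within UNIV)"
      if "t \<in> cbox c d" for y t
      using V_grad[of t y] that cd by (auto simp: gderiv_def)
    show "(\<lambda>t. V t y) integrable_on cbox c d" for y using V_integrable[OF cd] by simp
    have "continuous_on (UNIV \<times> cbox c d) (\<lambda>z. (\<lambda>(t, x). V\<^sub>x t x) (snd z, fst z))"
      by (rule continuous_on_compose2[OF Vx_cont]) (use cd in \<open>auto intro!: continuous_intros\<close>)
    then have "continuous_on (UNIV \<times> cbox c d) (\<lambda>z. blinfun_inner_left ((\<lambda>(t, x). V\<^sub>x t x) (snd z, fst z)))"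
      by (rule bounded_linear.continuous_on[OF bounded_linear_blinfun_inner_left])
    then show "continuous_on (UNIV \<times> cbox c d) (\<lambda>(y, t). blinfun_inner_left (V\<^sub>x t y))"
      by (simp add: split_def)
  qed auto
  have "continuous_on {c..d} (\<lambda>t. V\<^sub>x t y)"
    using continuous_on_subset[OF Vx_continuous[of "\<lambda>_. y"] cd] by (auto intro!: continuous_intros)
  then have "continuous_on {c..d} (\<lambda>t. blinfun_inner_left (V\<^sub>x t y))"
    by (rule bounded_linear.continuous_on[OF bounded_linear_blinfun_inner_left])
  then have int: "(\<lambda>t. blinfun_inner_left (V\<^sub>x t y)) integrable_on {c..d}" by (rule integrable_continuous_real)
  have eq: "blinfun_apply (integral {c..d} (\<lambda>t. blinfun_inner_left (V\<^sub>x t y))) h = h \<bullet> integral {c..d} (\<lambda>t. V\<^sub>x t y)" for h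
  proof -
    \<comment> \<open>Evaluation at \<open>h\<close> is bounded linear, hence commutes with the
      operator-valued integral that the Leibniz rule produces.\<close>
    have "bounded_linear (\<lambda>F::'a \<Rightarrow>\<^sub>L real. blinfun_apply F h)"
      by (intro bounded_linear_intros)
    from integral_linear[OF int this]
    have "blinfun_apply (integral {c..d} (\<lambda>t. blinfun_inner_left (V\<^sub>x t y))) h = integral {c..d} (\<lambda>t. h \<bullet> V\<^sub>x t y)"
      by (simp add: o_def)
    also have "\<dots> = h \<bullet> integral {c..d} (\<lambda>t. V\<^sub>x t y)"
      using integral_linear[OF Vx_integrable[OF cd] bounded_linear_inner_right, of h y] by (simp add: o_def)
    finally show ?thesis .
  qed
  have 1: "((\<lambda>y. integral {c..d} (\<lambda>t. V t y)) has_derivative (\<lambda>h. h \<bullet> integral {c..d} (\<lambda>t. V\<^sub>x t y))) (at y)"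
    using bi by (simp add: eq[abs_def, symmetric] eta_contract_eq)
  have 2: "((\<lambda>y. y \<bullet> integral {c..d} f) has_derivative (\<lambda>h. h \<bullet> integral {c..d} f)) (at y)"
    by (auto intro!: derivative_eq_intros)
  have fi: "integral {c..d} (\<lambda>t. f t \<bullet> y) = y \<bullet> integral {c..d} f" "(\<lambda>t. f t \<bullet> y) integrable_on {c..d}" for y
    using integral_linear[OF f_integrable[OF cd] bounded_linear_inner_left, of y]
      integrable_linear[OF f_integrable[OF cd] bounded_linear_inner_left, of y]
    by (simp_all add: o_def inner_commute)
  have "(\<lambda>y. integral {c..d} (\<lambda>t. V t y + f t \<bullet> y)) = (\<lambda>y. integral {c..d} (\<lambda>t. V t y) + y \<bullet> integral {c..d} f)"
    using fi V_integrable[OF cd] by (simp add: integral_add)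
  moreover have "integral {c..d} (\<lambda>t. V\<^sub>x t y + f t) = integral {c..d} (\<lambda>t. V\<^sub>x t y) + integral {c..d} f"
    by (intro integral_add Vx_integrable f_integrable cd)
  ultimately show ?thesis
    using has_derivative_add[OF 1 2] by (simp add: gderiv_def inner_add_right)
qed

text \<open>Minimises a discrete action under the constraint on \<open>energy\<close>. The lower
  bound makes the minimiser satisfy this constraint strictly, so small variations of an interior
  node remain admissible and give the equation at that node.\<close>

lemma discrete_solution:
  assumes "grid T h m"
  obtains x where "x 0 = x m" "\<And>i. norm (x i) \<le> \<rho>\<^sub>0" "grid.energy h m G x \<le> r"
    "\<And>i. 0 < i \<Longrightarrow> i < m \<Longrightarrow> g (grid.slope h x i) - g (grid.slope h x (i - 1)) =
      integral {grid.node T h i..grid.node T h (Suc i)} (\<lambda>t. V\<^sub>x t (x i) + f t)"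
proof -
  interpret grid T h m by fact
  define A where "A = (\<lambda>i y. integral {node i..node (Suc i)} (\<lambda>t. V t y + f t \<bullet> y))"
  define A' where "A' = (\<lambda>i y. integral {node i..node (Suc i)} (\<lambda>t. V\<^sub>x t y + f t))"
  have sub: "{node i..node (Suc i)} \<subseteq> {-T..T}" if "i < m" for i
    using node_bounds[of i] node_bounds[of "Suc i"] that by auto
  have A_grad: "GDERIV (A i) y :> A' i y" if "i < m" for i y
    unfolding A_def A'_def by (rule GDERIV_integral[OF sub[OF that]])
  \<comment> \<open>In each cell the potential is evaluated at the left node value instead of along
    the interpolant, so each \<open>x j\<close> enters a single \<open>A j\<close>.\<close>
  define I where "I = (\<lambda>x. \<Sum>j<m. h * G (slope x j) + A j (x j))"
  have x_le: "norm (x i) \<le> \<rho>\<^sub>0" if "x 0 = x m" "energy G x \<le> r" "i \<le> m" for x :: "nat \<Rightarrow> 'a" and i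
    using embed[OF interp_orlicz_sobolev(1)[OF G that(1)], of "node i"]
      interp_orlicz_sobolev(2)[OF G that(1)] that interp_node[OF that(3), of x] node_bounds[OF that(3)] by simp
  have Gs: "continuous_on UNIV (\<lambda>x. G (slope x j))" for j
    by (rule continuous_on_compose2[OF G_function_continuous[OF G]])
       (auto simp: slope_def intro!: continuous_intros)
  have Gx: "continuous_on UNIV (\<lambda>x. G (x j))" for j :: nat
    by (rule continuous_on_compose2[OF G_function_continuous[OF G]]) auto
  have Ac: "continuous_on UNIV (A j)" if "j < m" for j
    using A_grad[OF that] unfolding gderiv_def
    by (meson continuous_at_imp_continuous_on has_derivative_continuous)
  have Ax: "continuous_on UNIV (\<lambda>x. A j (x j))" if "j < m" for j
    by (rule continuous_on_compose2[OF Ac[OF that]]) auto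
  have I_cont: "continuous_on UNIV I"
    unfolding I_def by (intro continuous_intros Gs Ax) auto
  have E_cont: "continuous_on UNIV (energy G)"
    unfolding energy_def by (intro continuous_intros Gs Gx)
  \<comment> \<open>Sequences have infinitely many entries; bounding all of them puts
    \<open>S\<close> inside a product of balls, compact by Tychonoff. By \<open>x_le\<close>, varied
    sequences keep this bound at the nodes.\<close>
  define S where "S = {x :: nat \<Rightarrow> 'a. x 0 = x m \<and> energy G x \<le> r \<and> (\<forall>i. norm (x i) \<le> \<rho>\<^sub>0)}"
  have "compactin (product_topology (\<lambda>i::nat. euclidean) UNIV) (PiE UNIV (\<lambda>i. cball (0::'a) \<rho>\<^sub>0))"
    by (subst compactin_PiE) auto
  then have cpt: "compact (PiE UNIV (\<lambda>i::nat. cball (0::'a) \<rho>\<^sub>0))"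
    by (simp add: euclidean_product_topology)
  have "closed {x :: nat \<Rightarrow> 'a. x 0 = x m \<and> energy G x \<le> r}"
    by (intro closed_Collect_conj closed_Collect_eq closed_Collect_le E_cont continuous_intros continuous_on_product_coordinates)
  then have "compact (PiE UNIV (\<lambda>i::nat. cball (0::'a) \<rho>\<^sub>0) \<inter> {x. x 0 = x m \<and> energy G x \<le> r})"
    by (rule compact_Int_closed[OF cpt])
  moreover have "PiE UNIV (\<lambda>i::nat. cball (0::'a) \<rho>\<^sub>0) \<inter> {x. x 0 = x m \<and> energy G x \<le> r} = S"
    by (auto simp: S_def PiE_def)
  ultimately have S: "compact S" by simp
  have S0: "(\<lambda>_. 0) \<in> S"
    using \<rho>\<^sub>0_nonneg r_pos by (simp add: S_def energy_def slope_def G_0)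
  obtain x where x: "x \<in> S" "\<And>y. y \<in> S \<Longrightarrow> I x \<le> I y"
    using continuous_attains_inf[OF S _ continuous_on_subset[OF I_cont]] S0 by blast
  have "I (\<lambda>_. 0) = 0"
  proof -
    have "((\<lambda>t. V t 0) has_integral (\<Sum>j<m. A j 0)) {-T..node m}"
      using sub V_integrable by (intro has_integral_cells[where g = "\<lambda>j t. V t 0"]) (auto simp: A_def intro!: integrable_integral)
    then show ?thesis using V_0 by (simp add: I_def slope_def G_0 integral_unique)
  qed
  then have "I x \<le> 0" using x(2)[OF S0] by simp
  have Ilow: "min 1 \<beta> * energy G x - integral {-T..T} \<alpha> \<le> I x"
  proof -
    define a where "a = (\<lambda>j. integral {node j..node (Suc j)} \<alpha>)"
    have ai: "\<alpha> integrable_on {node j..node (Suc j)}" if "j < m" for j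
      using \<alpha> sub[OF that] integrable_on_subinterval by blast
    have "(\<alpha> has_integral (\<Sum>j<m. a j)) {-T..node m}"
      using ai by (intro has_integral_cells[where g = "\<lambda>j. \<alpha>"]) (auto simp: a_def intro!: integrable_integral)
    then have a: "integral {-T..T} \<alpha> = (\<Sum>j<m. a j)" by (simp add: integral_unique)
    have Aj: "\<beta> * (h * G (x j)) - a j \<le> A j (x j)" if j: "j < m" for j
    proof -
      have "((\<lambda>t. \<beta> * G (x j) - \<alpha> t) has_integral (h * (\<beta> * G (x j)) - a j)) {node j..node (Suc j)}"
        using has_integral_diff[OF has_integral_const_real[of "\<beta> * G (x j)" "node j" "node (Suc j)"] integrable_integral[OF ai[OF j]]]
          h_pos by (simp add: a_def node_Suc)
      moreover have "((\<lambda>t. V t (x j) + f t \<bullet> x j) has_integral A j (x j)) {node j..node (Suc j)}"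
        unfolding A_def
        by (intro integrable_integral integrable_add V_integrable[OF sub[OF j]]
            integrable_linear[OF f_integrable[OF sub[OF j]] bounded_linear_inner_left, unfolded o_def])
      moreover have "\<beta> * G (x j) - \<alpha> t \<le> V t (x j) + f t \<bullet> x j" if "t \<in> {node j..node (Suc j)}" for t
        using that sub[OF j] x(1) by (intro lower) (auto simp: S_def)
      ultimately have "h * (\<beta> * G (x j)) - a j \<le> A j (x j)" by (rule has_integral_le)
      then show ?thesis by (simp add: algebra_simps)
    qed
    have "min 1 \<beta> * (h * (G (slope x j) + G (x j))) - a j \<le> h * G (slope x j) + A j (x j)" if "j < m" for j
    proof -
      have "min 1 \<beta> * (h * G (slope x j)) \<le> 1 * (h * G (slope x j))"
        using h_pos G_nonneg by (intro mult_right_mono) auto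
      moreover have "min 1 \<beta> * (h * G (x j)) \<le> \<beta> * (h * G (x j))"
        using h_pos G_nonneg by (intro mult_right_mono) auto
      ultimately show ?thesis using Aj[OF that] by (simp add: distrib_left)
    qed
    then have "(\<Sum>j<m. min 1 \<beta> * (h * (G (slope x j) + G (x j))) - a j) \<le> I x"
      unfolding I_def by (intro sum_mono) auto
    then show ?thesis by (simp add: energy_def a sum_subtractf sum_distrib_left)
  qed
  \<comment> \<open>The strictness of \<open>small\<close> keeps the minimiser off the boundary of
    the sublevel set.\<close>
  then have "min 1 \<beta> * energy G x < min 1 \<beta> * r" using \<open>I x \<le> 0\<close> small by linarith
  then have xr: "energy G x < r" using \<beta> by (simp add: mult_less_cancel_left_pos)
  have EL: "g (slope x i) - g (slope x (i - 1)) = A' i (x i)" if i: "0 < i" "i < m" for i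
  proof -
    have "(g (slope x (i - 1)) - g (slope x i) + A' i (x i)) \<bullet> \<eta> = 0" for \<eta>
    proof -
      \<comment> \<open>A bump at the single node \<open>i\<close>; as \<open>0 < i < m\<close>, it
        leaves \<open>x 0\<close> and \<open>x m\<close> unchanged.\<close>
      define \<phi> where "\<phi> = (\<lambda>j. if j = i then \<eta> else 0)"
      define y where "y = (\<lambda>s j. x j + s *\<^sub>R \<phi> j)"
      have ys: "slope (y s) j = slope x j + s *\<^sub>R slope \<phi> j" for s j
        by (simp add: y_def slope_def algebra_simps)
      have "((\<lambda>s. I (y s)) has_real_derivative (\<Sum>j<m. h * (slope \<phi> j \<bullet> g (slope x j)) + \<phi> j \<bullet> A' j (x j))) (at 0)"
        unfolding I_def ys unfolding y_def
        by (intro DERIV_sum DERIV_add DERIV_cmult GDERIV_along_line G_grad A_grad) auto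
      moreover have "\<exists>\<delta>>0. \<forall>s. \<bar>0 - s\<bar> < \<delta> \<longrightarrow> I (y 0) \<le> I (y s)"
      proof -
        have "continuous_on UNIV y"
          unfolding y_def by (intro continuous_intros)
        then have "continuous_on UNIV (\<lambda>s. energy G (y s))"
          by (intro continuous_on_compose2[OF E_cont]) auto
        then have "isCont (\<lambda>s. energy G (y s)) 0" by (simp add: continuous_on_eq_continuous_at)
        moreover have y0: "y 0 = x" by (simp add: y_def)
        ultimately have "(\<lambda>s. energy G (y s)) \<midarrow>0\<rightarrow> energy G x" by (simp add: isCont_def)
        then have "eventually (\<lambda>s. energy G (y s) < r) (at 0)" using xr by (rule order_tendstoD)
        then obtain \<delta> where \<delta>: "\<delta> > 0" "\<And>s. s \<noteq> 0 \<Longrightarrow> \<bar>s\<bar> < \<delta> \<Longrightarrow> energy G (y s) < r"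
          by (auto simp: eventually_at dist_real_def)
        have "I (y 0) \<le> I (y s)" if s: "\<bar>0 - s\<bar> < \<delta>" for s
        proof (cases "s = 0")
          case False
          have e: "energy G (y s) \<le> r" using \<delta>(2)[OF False] s by simp
          have p: "y s 0 = y s m" using x(1) i by (simp add: y_def \<phi>_def S_def)
          have "norm (y s j) \<le> \<rho>\<^sub>0" for j
          proof (cases "j \<le> m")
            case False
            then have "y s j = x j" using i by (simp add: y_def \<phi>_def)
            then show ?thesis using x(1) by (simp add: S_def)
          qed (rule x_le[OF p e])
          then have "y s \<in> S" using e p by (simp add: S_def)
          then show ?thesis using x(2) y0 by simp
        qed simp
        then show ?thesis using \<delta>(1) by blast
      qed
      ultimately have D: "(\<Sum>j<m. h * (slope \<phi> j \<bullet> g (slope x j)) + \<phi> j \<bullet> A' j (x j)) = 0"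
        using DERIV_local_min by blast
      \<comment> \<open>Summation by parts: the bump has slope \<open>\<eta> / h\<close> on cell
        \<open>i - 1\<close> and \<open>- \<eta> / h\<close> on cell \<open>i\<close>, and the
        factor \<open>h\<close> cancels.\<close>
      have "h * (slope \<phi> j \<bullet> g (slope x j)) + \<phi> j \<bullet> A' j (x j) =
        (if j = i - 1 then \<eta> \<bullet> g (slope x j) else 0) - (if j = i then \<eta> \<bullet> g (slope x j) else 0)
         + (if j = i then \<eta> \<bullet> A' j (x j) else 0)" for j
        using h_pos i by (auto simp: slope_def \<phi>_def inner_diff_left)
      then have "(\<Sum>j<m. h * (slope \<phi> j \<bullet> g (slope x j)) + \<phi> j \<bullet> A' j (x j)) =
        \<eta> \<bullet> g (slope x (i - 1)) - \<eta> \<bullet> g (slope x i) + \<eta> \<bullet> A' i (x i)"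
        using i by (simp add: sum.distrib sum_subtractf)
      with D show ?thesis by (simp add: inner_add_left inner_diff_left inner_add_right inner_diff_right inner_commute)
    qed
    then have "g (slope x (i - 1)) - g (slope x i) + A' i (x i) = 0"
      using inner_eq_zero_iff by blast
    then show ?thesis by (simp add: algebra_simps)
  qed
  show thesis
    using x(1) xr EL by (intro that[of x]) (auto simp: S_def A'_def)
qed

end

section \<open>Passage to the limit\<close>

context grid
begin

lemma integral_cell:
  fixes g :: "nat \<Rightarrow> real \<Rightarrow> 'b::euclidean_space"
  assumes "j < m"
  shows "integral {node j..node (Suc j)} (\<lambda>t. g (cell t) t) = integral {node j..node (Suc j)} (g j)"
  by (rule integral_spike[of "{node (Suc j)}"]) (use cell_eq[OF assms] in auto)

lemma interp_Lipschitz: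
  assumes R: "\<And>i. i < m \<Longrightarrow> norm (slope x i) \<le> R" and st: "s \<in> {-T..T}" "t \<in> {-T..T}"
  shows "norm (interp x t - interp x s) \<le> R * \<bar>t - s\<bar>"
proof -
  have *: "norm (interp x t - interp x s) \<le> R * (t - s)" if "-T \<le> s" "s \<le> t" "t \<le> T" for s t
  proof -
    have "norm (integral {s..t} (\<lambda>r. slope x (cell r))) \<le> integral {s..t} (\<lambda>r. R)"
      using that by (intro integral_norm_bound_integral step_integrable R cell_less) auto
    then show ?thesis using that by (simp add: interp_diff mult.commute)
  qed
  show ?thesis
    using *[of s t] *[of t s] st by (cases "s \<le> t") (auto simp: norm_minus_commute)
qed

end

context action
begin

text \<open>Reduces to the tangent inequality for a convex function of one variable, along the line
  through \<open>x\<close> and \<open>y\<close>.\<close>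

lemma G_above_tangent: "G x + (y - x) \<bullet> g x \<le> G y"
proof -
  have c: "convex_on UNIV (\<lambda>s. G (x + s *\<^sub>R (y - x)))"
  proof (rule convex_onI)
    fix t a b :: real assume "0 < t" "t < 1"
    then have "G ((1 - t) *\<^sub>R (x + a *\<^sub>R (y - x)) + t *\<^sub>R (x + b *\<^sub>R (y - x)))
        \<le> (1 - t) * G (x + a *\<^sub>R (y - x)) + t * G (x + b *\<^sub>R (y - x))"
      by (intro convex_onD[OF G_convex]) auto
    moreover have "(1 - t) *\<^sub>R (x + a *\<^sub>R (y - x)) + t *\<^sub>R (x + b *\<^sub>R (y - x)) =
        x + ((1 - t) *\<^sub>R a + t *\<^sub>R b) *\<^sub>R (y - x)"
      by (simp add: algebra_simps)
    ultimately show "G (x + ((1 - t) *\<^sub>R a + t *\<^sub>R b) *\<^sub>R (y - x))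
        \<le> (1 - t) * G (x + a *\<^sub>R (y - x)) + t * G (x + b *\<^sub>R (y - x))"
      by simp
  qed simp
  have "((\<lambda>s. G (x + s *\<^sub>R (y - x))) has_real_derivative ((y - x) \<bullet> g x)) (at 0 within UNIV)"
    using GDERIV_along_line[OF G_grad] by simp
  from convex_on_imp_above_tangent[OF c _ _ _ this, of 1] show ?thesis by simp
qed

lemma g_monotone: "0 \<le> (g x - g y) \<bullet> (x - y)"
  using G_above_tangent[of x y] G_above_tangent[of y x]
  by (simp add: inner_diff_left inner_diff_right inner_commute)

text \<open>Test with \<open>z = D - e *\<^sub>R \<eta>\<close>, divide by \<open>e > 0\<close> and
  let \<open>e\<close> tend to zero, using continuity of \<open>g\<close>; since
  \<open>\<eta>\<close> is arbitrary, the choice \<open>\<eta> = g D - q\<close> forces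
  equality.\<close>

lemma Minty:
  assumes "\<And>z. 0 \<le> (q - g z) \<bullet> (D - z)"
  shows "g D = q"
proof -
  have "0 \<le> (q - g D) \<bullet> \<eta>" for \<eta>
  proof (rule tendsto_lowerbound)
    have "isCont g D" using g_cont by (simp add: continuous_on_eq_continuous_at)
    then have "((\<lambda>e. g (D - e *\<^sub>R \<eta>)) \<longlongrightarrow> g (D - 0 *\<^sub>R \<eta>)) (at_right 0)"
      by (intro isCont_tendsto_compose[of _ g] tendsto_intros) auto
    then show "((\<lambda>e. (q - g (D - e *\<^sub>R \<eta>)) \<bullet> \<eta>) \<longlongrightarrow> (q - g D) \<bullet> \<eta>) (at_right 0)"
      by (intro tendsto_intros) simp
    show "eventually (\<lambda>e. 0 \<le> (q - g (D - e *\<^sub>R \<eta>)) \<bullet> \<eta>) (at_right (0::real))"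
      unfolding eventually_at_right_field
    proof (intro exI[of _ 1] conjI allI impI)
      fix e :: real assume "0 < e"
      moreover have "0 \<le> e * ((q - g (D - e *\<^sub>R \<eta>)) \<bullet> \<eta>)" using assms[of "D - e *\<^sub>R \<eta>"] by simp
      ultimately show "0 \<le> (q - g (D - e *\<^sub>R \<eta>)) \<bullet> \<eta>" by (simp add: zero_le_mult_iff)
    qed simp
  qed simp
  from this[of "g D - q"] have "(g D - q) \<bullet> (g D - q) \<le> 0"
    by (simp add: inner_diff_left inner_diff_right inner_commute)
  then have "(g D - q) \<bullet> (g D - q) = 0" by (intro antisym inner_ge_zero)
  then show ?thesis by simp
qed

text \<open>The tangent at \<open>v\<close>, evaluated at \<open>0\<close>, gives
  \<open>G v \<le> v \<bullet> g v \<le> norm v * norm (g v)\<close>, so a bounded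
  \<open>g v\<close> is incompatible with superlinear growth once \<open>norm v\<close> is
  large.\<close>

lemma g_coercive: obtains R where "R > 0" "\<And>v. norm (g v) \<le> B \<Longrightarrow> norm v \<le> R"
proof -
  obtain R where R: "R > 0" "\<And>v. norm v \<ge> R \<Longrightarrow> G v \<ge> (\<bar>B\<bar> + 1) * norm v"
    using G_function_superlinear[OF G] by blast
  have "norm v \<le> R" if v: "norm (g v) \<le> B" for v
  proof (rule ccontr)
    assume "\<not> norm v \<le> R"
    then have vR: "norm v > R" by simp
    have "G v \<le> v \<bullet> g v" using G_above_tangent[of v 0] by (simp add: G_0)
    also have "\<dots> \<le> norm v * norm (g v)" by (rule norm_cauchy_schwarz)
    also have "\<dots> \<le> norm v * \<bar>B\<bar>" using v by (intro mult_left_mono) auto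
    also have "\<dots> < norm v * (\<bar>B\<bar> + 1)" using vR R(1) by (intro mult_strict_left_mono) auto
    also have "\<dots> \<le> G v" using R(2)[of v] vR by (simp add: mult.commute)
    finally show False by simp
  qed
  then show thesis using that R(1) by blast
qed

lemma g_bounded_sublevel: obtains B where "\<And>v. G v \<le> c \<Longrightarrow> norm (g v) \<le> B"
proof -
  obtain R where R: "R > 0" "\<And>v. norm v \<ge> R \<Longrightarrow> G v \<ge> 1 * norm v"
    using G_function_superlinear[OF G] by blast
  have v: "norm v \<le> max R c" if "G v \<le> c" for v
    using R(2)[of v] that by (cases "norm v \<ge> R") auto
  have "bounded (g ` cball 0 (max R c))"
    by (intro compact_imp_bounded compact_continuous_image continuous_on_subset[OF g_cont]) auto
  then obtain B where "\<And>y. y \<in> g ` cball 0 (max R c) \<Longrightarrow> norm y \<le> B" by (auto simp: bounded_iff)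
  then show thesis using v by (intro that[of B]) auto
qed

lemma Vx_bounded: obtains M where "M \<ge> 0" "\<And>t x. t \<in> {-T..T} \<Longrightarrow> norm x \<le> \<rho>\<^sub>0 \<Longrightarrow> norm (V\<^sub>x t x) \<le> M"
proof -
  have "bounded ((\<lambda>(t, x). V\<^sub>x t x) ` ({-T..T} \<times> cball 0 \<rho>\<^sub>0))"
    by (intro compact_imp_bounded compact_continuous_image continuous_on_subset[OF Vx_cont] compact_Times) auto
  then obtain M where M: "\<forall>y\<in>(\<lambda>(t, x). V\<^sub>x t x) ` ({-T..T} \<times> cball 0 \<rho>\<^sub>0). norm y \<le> M"
    unfolding bounded_iff by blast
  show thesis
  proof (rule that[of "max 0 M"])
    fix t and x :: 'a assume "t \<in> {-T..T}" "norm x \<le> \<rho>\<^sub>0"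
    then have "V\<^sub>x t x \<in> (\<lambda>(t, x). V\<^sub>x t x) ` ({-T..T} \<times> cball 0 \<rho>\<^sub>0)"
      by (intro image_eqI[of _ _ "(t, x)"]) auto
    with M have "norm (V\<^sub>x t x) \<le> M" by (rule bspec)
    then show "norm (V\<^sub>x t x) \<le> max 0 M" by simp
  qed simp
qed

lemma norm_f_integrable: "{c..d} \<subseteq> {-T..T} \<Longrightarrow> (\<lambda>t. M + norm (f t)) integrable_on {c..d}"
  by (intro integrable_add integrable_on_subinterval[OF set_lebesgue_integral_eq_integral(1)[OF set_integrable_norm[OF f]]])
     auto

lemma step_force_integrable:
  assumes "grid T h m" and cd: "{c..d} \<subseteq> {-T..T}"
  shows "(\<lambda>t. V\<^sub>x t (x (grid.cell T h m t)) + f t) integrable_on {c..d}"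
proof -
  interpret grid T h m by fact
  have "((\<lambda>t. V\<^sub>x t (x (cell t)) + f t) has_integral
      (\<Sum>j<m. integral {node j..node (Suc j)} (\<lambda>t. V\<^sub>x t (x j) + f t))) {-T..node m}"
  proof (rule has_integral_cells[OF order_refl])
    fix j assume "j < m"
    then have "{node j..node (Suc j)} \<subseteq> {-T..T}"
      using node_bounds[of j] node_bounds[of "Suc j"] by auto
    then show "((\<lambda>t. V\<^sub>x t (x j) + f t) has_integral integral {node j..node (Suc j)} (\<lambda>t. V\<^sub>x t (x j) + f t))
        {node j..node (Suc j)}"
      by (intro integrable_integral integrable_add Vx_integrable f_integrable)
  qed
  then have "(\<lambda>t. V\<^sub>x t (x (cell t)) + f t) integrable_on {-T..T}" by (auto simp: integrable_on_def)
  then show ?thesis using cd by (rule integrable_on_subinterval)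
qed

text \<open>Sums the discrete equations at the nodes \<open>1\<close> to \<open>i\<close>. The
  integral starts at \<open>node 1\<close> because there is no equation at node \<open>0\<close>;
  the missing first cell disappears as \<open>h\<close> tends to zero.\<close>

lemma discrete_momentum:
  assumes "grid T h m"
    and EL: "\<And>i. 0 < i \<Longrightarrow> i < m \<Longrightarrow> g (grid.slope h x i) - g (grid.slope h x (i - 1)) =
      integral {grid.node T h i..grid.node T h (Suc i)} (\<lambda>t. V\<^sub>x t (x i) + f t)"
    and i: "i < m"
  shows "g (grid.slope h x i) = g (grid.slope h x 0) +
      integral {grid.node T h 1..grid.node T h (Suc i)} (\<lambda>t. V\<^sub>x t (x (grid.cell T h m t)) + f t)"
proof -
  interpret grid T h m by fact
  show ?thesis
    using i
  proof (induction i)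
    case 0
    then show ?case by simp
  next
    case (Suc i)
    let ?w = "\<lambda>t. V\<^sub>x t (x (cell t)) + f t"
    have "node 1 \<le> node (Suc i)" "node (Suc i) \<le> node (Suc (Suc i))" by (rule node_mono; simp)+
    moreover have "?w integrable_on {node 1..node (Suc (Suc i))}"
      using node_bounds[of 1] node_bounds[of "Suc (Suc i)"] Suc.prems
      by (intro step_force_integrable[OF assms(1)]) auto
    ultimately have "integral {node 1..node (Suc i)} ?w + integral {node (Suc i)..node (Suc (Suc i))} ?w
        = integral {node 1..node (Suc (Suc i))} ?w"
      by (intro Henstock_Kurzweil_Integration.integral_combine)
    moreover have "integral {node (Suc i)..node (Suc (Suc i))} ?w =
        integral {node (Suc i)..node (Suc (Suc i))} (\<lambda>t. V\<^sub>x t (x (Suc i)) + f t)"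
      using integral_cell[OF Suc.prems, of "\<lambda>j t. V\<^sub>x t (x j) + f t"] .
    ultimately show ?case
      using EL[of "Suc i"] Suc by (simp add: algebra_simps)
  qed
qed

lemma norm_integral_force_le:
  fixes w :: "real \<Rightarrow> 'a"
  assumes cd: "{c..d} \<subseteq> {-T..T}" and w: "w integrable_on {c..d}"
    and b: "\<And>t. t \<in> {c..d} \<Longrightarrow> norm (w t) \<le> M + norm (f t)"
  shows "norm (integral {c..d} w) \<le> integral {c..d} (\<lambda>t. M + norm (f t))"
  by (rule Henstock_Kurzweil_Integration.integral_norm_bound_integral[OF w norm_f_integrable[OF cd] b])

text \<open>Averaging over the total length \<open>2 * T\<close> finds a cell with
  \<open>G (slope x j) \<le> r / (2 * T)\<close>. Its momentum is bounded, all other momenta differ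
  from it by integrals of forces, and coercivity then bounds the slopes. None of the constants
  depends on the grid.\<close>

lemma discrete_bounds:
  obtains B R where "R > 0"
    "\<And>h m x i. grid T h m \<Longrightarrow> x 0 = x m \<Longrightarrow> (\<And>i. norm (x i) \<le> \<rho>\<^sub>0) \<Longrightarrow> grid.energy h m G x \<le> r \<Longrightarrow>
      (\<And>i. 0 < i \<Longrightarrow> i < m \<Longrightarrow> g (grid.slope h x i) - g (grid.slope h x (i - 1)) =
        integral {grid.node T h i..grid.node T h (Suc i)} (\<lambda>t. V\<^sub>x t (x i) + f t)) \<Longrightarrow>
      i < m \<Longrightarrow> norm (g (grid.slope h x i)) \<le> B \<and> norm (grid.slope h x i) \<le> R"
proof -
  obtain M where M: "M \<ge> 0" "\<And>t x. t \<in> {-T..T} \<Longrightarrow> norm x \<le> \<rho>\<^sub>0 \<Longrightarrow> norm (V\<^sub>x t x) \<le> M"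
    by (rule Vx_bounded) blast
  define B1 where "B1 = integral {-T..T} (\<lambda>t. M + norm (f t))"
  obtain B0 where B0: "\<And>v. G v \<le> r / (2 * T) \<Longrightarrow> norm (g v) \<le> B0"
    using g_bounded_sublevel[of "r / (2 * T)"] by blast
  \<comment> \<open>\<open>B1\<close> is counted twice because the momenta in cells \<open>i\<close>
    and \<open>j\<close> are compared through cell \<open>0\<close>.\<close>
  define B where "B = B0 + 2 * B1"
  obtain R where R: "R > 0" "\<And>v. norm (g v) \<le> B \<Longrightarrow> norm v \<le> R"
    using g_coercive[of B] by blast
  show thesis
  proof (rule that[OF R(1)])
    fix h m i and x :: "nat \<Rightarrow> 'a"
    assume grid: "grid T h m" and x0: "x 0 = x m" and xb: "\<And>i. norm (x i) \<le> \<rho>\<^sub>0"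
      and en: "grid.energy h m G x \<le> r" and im: "i < m"
      and EL: "\<And>i. 0 < i \<Longrightarrow> i < m \<Longrightarrow> g (grid.slope h x i) - g (grid.slope h x (i - 1)) =
        integral {grid.node T h i..grid.node T h (Suc i)} (\<lambda>t. V\<^sub>x t (x i) + f t)"
    interpret grid T h m by fact
    let ?w = "\<lambda>t. V\<^sub>x t (x (cell t)) + f t"
    have J: "norm (g (slope x j) - g (slope x 0)) \<le> B1" if j: "j < m" for j
    proof -
      have sub: "{node 1..node (Suc j)} \<subseteq> {-T..T}"
        using node_bounds[of 1] node_bounds[of "Suc j"] j by auto
      have "norm (g (slope x j) - g (slope x 0)) = norm (integral {node 1..node (Suc j)} ?w)"
        using discrete_momentum[OF grid EL j] by simp
      also have "\<dots> \<le> integral {node 1..node (Suc j)} (\<lambda>t. M + norm (f t))"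
        using sub M(2) xb
        by (intro norm_integral_force_le step_force_integrable[OF grid])
           (auto intro!: order_trans[OF norm_triangle_ineq] add_right_mono)
      also have "\<dots> \<le> B1"
        unfolding B1_def using sub M(1) by (intro integral_subset_le norm_f_integrable) auto
      finally show ?thesis .
    qed
    have "\<exists>j<m. G (slope x j) \<le> r / (2 * T)"
    proof (rule ccontr)
      assume "\<not> (\<exists>j<m. G (slope x j) \<le> r / (2 * T))"
      then have a: "r / (2 * T) < G (slope x j)" if "j < m" for j
        using that by (meson not_le)
      have "r = (\<Sum>j<m. h * (r / (2 * T)))" using m T_pos by (simp add: h)
      also have "\<dots> < (\<Sum>j<m. h * (G (slope x j) + G (x j)))"
      proof (rule sum_strict_mono)
        fix j assume "j \<in> {..<m}"
        then have "r / (2 * T) < G (slope x j)" by (intro a) simp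
        also have "\<dots> \<le> G (slope x j) + G (x j)" by (simp add: G_nonneg)
        finally show "h * (r / (2 * T)) < h * (G (slope x j) + G (x j))"
          using h_pos by (rule mult_strict_left_mono)
      qed (use m in auto)
      finally show False using en by (simp add: energy_def)
    qed
    then obtain j where j: "j < m" "G (slope x j) \<le> r / (2 * T)" by blast
    have "g (slope x i) = g (slope x j) + (g (slope x i) - g (slope x 0)) - (g (slope x j) - g (slope x 0))"
      by simp
    also have "norm \<dots> \<le> norm (g (slope x j)) + norm (g (slope x i) - g (slope x 0)) + norm (g (slope x j) - g (slope x 0))"
      by (intro order_trans[OF norm_triangle_ineq4] add_mono order_trans[OF norm_triangle_ineq] order_refl)
    also have "\<dots> \<le> B" using B0[OF j(2)] J[OF im] J[OF j(1)] by (simp add: B_def)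
    finally show "norm (g (slope x i)) \<le> B \<and> norm (slope x i) \<le> R" using R(2) by blast
  qed
qed

lemma force_integrable:
  assumes "continuous_on {-T..T} u" "{c..d} \<subseteq> {-T..T}"
  shows "(\<lambda>t. V\<^sub>x t (u t) + f t) integrable_on {c..d}"
  using continuous_on_subset[OF Vx_continuous[OF assms(1)] assms(2)]
  by (intro integrable_add f_integrable assms(2) integrable_continuous_real)

text \<open>The integrated equation is claimed at every interior point where \<open>u\<close>
  happens to be differentiable. Since \<open>u\<close> is Lipschitz, almost every point is of this
  kind, so the equation can later be used almost everywhere.\<close>

lemma Euler_Lagrange_solution:
  obtains u c R where
    "\<And>s t. s \<in> {-T..T} \<Longrightarrow> t \<in> {-T..T} \<Longrightarrow> norm (u t - u s) \<le> R * \<bar>t - s\<bar>" "u (-T) = u T"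
    "\<And>s D. s \<in> {-T<..<T} \<Longrightarrow> (u has_vector_derivative D) (at s) \<Longrightarrow>
      g D = c + integral {-T..s} (\<lambda>t. V\<^sub>x t (u t) + f t)"
proof -

  \<comment> \<open>Discrete solutions on ever finer grids and their uniform bounds\<close>
  define h where "h = (\<lambda>k. 2 * T / real (Suc k))"
  have grid: "grid T (h k) (Suc k)" for k using T_pos by unfold_locales (auto simp: h_def)
  obtain B R where "R > 0" and BR: 
    "\<And>h m x i. grid T h m \<Longrightarrow> x 0 = x m \<Longrightarrow> (\<And>i. norm (x i) \<le> \<rho>\<^sub>0) \<Longrightarrow> grid.energy h m G x \<le> r \<Longrightarrow>
      (\<And>i. 0 < i \<Longrightarrow> i < m \<Longrightarrow> g (grid.slope h x i) - g (grid.slope h x (i - 1)) =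
        integral {grid.node T h i..grid.node T h (Suc i)} (\<lambda>t. V\<^sub>x t (x i) + f t)) \<Longrightarrow>
      i < m \<Longrightarrow> norm (g (grid.slope h x i)) \<le> B \<and> norm (grid.slope h x i) \<le> R"
    by (rule discrete_bounds) blast
  obtain M where M: "M \<ge> 0" "\<And>t x. t \<in> {-T..T} \<Longrightarrow> norm x \<le> \<rho>\<^sub>0 \<Longrightarrow> norm (V\<^sub>x t x) \<le> M"
    by (rule Vx_bounded) blast
  define Q where "Q = (\<lambda>k x. x 0 = x (Suc k) \<and> (\<forall>i. norm (x i) \<le> \<rho>\<^sub>0) \<and> grid.energy (h k) (Suc k) G x \<le> r \<and>
    (\<forall>i. 0 < i \<longrightarrow> i < Suc k \<longrightarrow> g (grid.slope (h k) x i) - g (grid.slope (h k) x (i - 1)) =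
      integral {grid.node T (h k) i..grid.node T (h k) (Suc i)} (\<lambda>t. V\<^sub>x t (x i) + f t)))"
  have "\<exists>x. Q k x" for k
    unfolding Q_def by (rule discrete_solution[OF grid[of k]]) blast
  then obtain X where "\<And>k. Q k (X k)" by metis
  then have X: "X k 0 = X k (Suc k)" "norm (X k i) \<le> \<rho>\<^sub>0" "grid.energy (h k) (Suc k) G (X k) \<le> r"
    "0 < i \<Longrightarrow> i < Suc k \<Longrightarrow> g (grid.slope (h k) (X k) i) - g (grid.slope (h k) (X k) (i - 1)) =
      integral {grid.node T (h k) i..grid.node T (h k) (Suc i)} (\<lambda>t. V\<^sub>x t (X k i) + f t)" for k i
    unfolding Q_def by blast+
  define cl where "cl = (\<lambda>k. grid.cell T (h k) (Suc k))"
  define nd where "nd = (\<lambda>k. grid.node T (h k))"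
  define sl where "sl = (\<lambda>k. grid.slope (h k) (X k))"
  define U where "U = (\<lambda>k. grid.interp T (h k) (Suc k) (X k))"
  define w where "w = (\<lambda>k t. V\<^sub>x t (X k (cl k t)) + f t)"
  define P where "P = (\<lambda>k t. g (sl k (cl k t)))"
  \<comment> \<open>A continuous primitive of the dominating function; its increments bound those of
    all force integrals, uniformly in \<open>k\<close>.\<close>
  define \<Theta> where "\<Theta> = (\<lambda>t. integral {-T..t} (\<lambda>t. M + norm (f t)))"
  have slb: "norm (g (sl k i)) \<le> B" "norm (sl k i) \<le> R" if "i < Suc k" for k i
    using BR[OF grid X(1,2,3,4) that] by (auto simp: sl_def)
  have cll: "cl k t < Suc k" for k t unfolding cl_def by (rule grid.cell_less[OF grid])
  have P_bound: "norm (P k t) \<le> B" for k t unfolding P_def by (rule slb(1)[OF cll])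
  have v_bound: "norm (sl k (cl k t)) \<le> R" for k t by (rule slb(2)[OF cll])
  have U_Lip: "norm (U k t - U k s) \<le> R * \<bar>t - s\<bar>" if "s \<in> {-T..T}" "t \<in> {-T..T}" for k s t
    unfolding U_def by (rule grid.interp_Lipschitz[OF grid _ that]) (use slb(2) in \<open>auto simp: sl_def\<close>)
  have U_diff: "U k t - U k s = integral {s..t} (\<lambda>r. sl k (cl k r))" if "-T \<le> s" "s \<le> t" "t \<le> T" for k s t
    unfolding U_def sl_def cl_def by (rule grid.interp_diff[OF grid that])
  have U_node: "U k (nd k i) = X k i" if "i \<le> Suc k" for k i
    unfolding U_def nd_def by (rule grid.interp_node[OF grid that])
  have U_bound: "norm (U k t) \<le> \<rho>\<^sub>0" if "t \<in> {-T..T}" for k t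
    unfolding U_def using grid.interp_orlicz_sobolev[OF grid G X(1)[of k]] X(3)[of k] that
    by (intro embed) (auto intro: order_trans)
  have nd0: "nd k 0 = -T" and ndm: "nd k (Suc k) = T" and ndS: "nd k (Suc i) = nd k i + h k" for k i
    unfolding nd_def by (rule grid.node_0[OF grid] grid.node_m[OF grid] grid.node_Suc[OF grid])+
  have ndb: "nd k i \<in> {-T..T}" if "i \<le> Suc k" for k i
    unfolding nd_def by (rule grid.node_bounds[OF grid that])
  have cb: "nd k (cl k t) \<le> t" "t \<le> nd k (Suc (cl k t))" if "t \<in> {-T..T}" for k t
    unfolding nd_def cl_def by (rule grid.cell_bounds[OF grid that])+
  have U_per: "U k (-T) = U k T" for k using U_node[of 0 k] U_node[of "Suc k" k] X(1)[of k] by (simp add: nd0 ndm)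
  have XU: "norm (X k (cl k t) - U k t) \<le> R * h k" if t: "t \<in> {-T..T}" for k t
  proof -
    have le: "cl k t \<le> Suc k" using cll[of k t] by simp
    have "norm (U k (nd k (cl k t)) - U k t) \<le> R * \<bar>nd k (cl k t) - t\<bar>"
      using t ndb[OF le] by (intro U_Lip)
    also have "\<dots> \<le> R * h k"
      using cb[OF t, of k] ndS[of k "cl k t"] \<open>R > 0\<close> by (intro mult_left_mono) auto
    finally show ?thesis by (simp add: U_node[OF le])
  qed
  have w_int: "w k integrable_on {c..d}" if "{c..d} \<subseteq> {-T..T}" for k c d
    unfolding w_def cl_def by (rule step_force_integrable[OF grid that])
  have w_bound: "norm (w k t) \<le> M + norm (f t)" if "t \<in> {-T..T}" for k t
    unfolding w_def using M(2)[OF that X(2)] by (intro order_trans[OF norm_triangle_ineq] add_right_mono)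
  have w_diff: "norm (integral {-T..d} (w k) - integral {-T..c} (w k)) \<le> \<Theta> d - \<Theta> c"
    if cd: "-T \<le> c" "c \<le> d" "d \<le> T" for k c d
  proof -
    have "integral {-T..c} (w k) + integral {c..d} (w k) = integral {-T..d} (w k)"
      using cd by (intro Henstock_Kurzweil_Integration.integral_combine w_int) auto
    moreover have "\<Theta> c + integral {c..d} (\<lambda>t. M + norm (f t)) = \<Theta> d"
      unfolding \<Theta>_def using cd by (intro Henstock_Kurzweil_Integration.integral_combine norm_f_integrable) auto
    moreover have "norm (integral {c..d} (w k)) \<le> integral {c..d} (\<lambda>t. M + norm (f t))"
      using cd by (intro norm_integral_force_le w_int w_bound) auto
    ultimately show ?thesis by (metis add_diff_cancel_left')
  qed
  have \<Theta>_cont: "continuous_on {-T..T} \<Theta>"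
    unfolding \<Theta>_def by (intro indefinite_integral_continuous_1 norm_f_integrable) simp
  \<comment> \<open>The force integral reaches to the right end of the cell of \<open>t\<close> and
    omits the first cell; both deviations from \<open>{-T..t}\<close> have length at most
    \<open>h k\<close>.\<close>
  have P_eq: "P k t = g (sl k 0) + (integral {-T..nd k (Suc (cl k t))} (w k) - integral {-T..nd k 1} (w k))" for k t
  proof -
    have "P k t = g (sl k 0) + integral {nd k 1..nd k (Suc (cl k t))} (w k)"
      unfolding P_def sl_def nd_def w_def unfolding cl_def
      by (rule discrete_momentum[OF grid X(4)]) (use cll in \<open>auto simp: cl_def\<close>)
    moreover have "integral {-T..nd k 1} (w k) + integral {nd k 1..nd k (Suc (cl k t))} (w k) =
        integral {-T..nd k (Suc (cl k t))} (w k)"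
    proof (intro Henstock_Kurzweil_Integration.integral_combine w_int)
      show "-T \<le> nd k 1" using ndb[of 1 k] by simp
      show "nd k 1 \<le> nd k (Suc (cl k t))" unfolding nd_def by (rule grid.node_mono[OF grid]) simp
      show "{-T..nd k (Suc (cl k t))} \<subseteq> {-T..T}" using ndb[of "Suc (cl k t)" k] cll[of k t] by auto
    qed
    ultimately show ?thesis by (metis add_diff_cancel_left')
  qed
  have h_lim: "h \<longlonglongrightarrow> 0"
    unfolding h_def using tendsto_mult[OF tendsto_const[of "2 * T"] LIMSEQ_inverse_real_of_nat] by (simp add: divide_inverse)

  \<comment> \<open>Extraction of a convergent subsequence\<close>
  obtain u \<kappa> where u_cont: "continuous_on {-T..T} u" and "strict_mono (\<kappa> :: nat \<Rightarrow> nat)"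
    and unif: "\<And>e. 0 < e \<Longrightarrow> \<exists>N. \<forall>n x. n \<ge> N \<and> x \<in> {-T..T} \<longrightarrow> norm (U (\<kappa> n) x - u x) < e"
  proof (rule Arzela_Ascoli[of "{-T..T}" U \<rho>\<^sub>0])
    fix x e :: real assume "x \<in> {-T..T}" "0 < e"
    have "norm (U n x - U n y) < e" if "y \<in> {-T..T}" "norm (x - y) < e / R" for n y
    proof -
      have "norm (U n x - U n y) \<le> R * \<bar>x - y\<bar>" using \<open>x \<in> {-T..T}\<close> that by (intro U_Lip)
      also have "\<dots> < e" using that \<open>R > 0\<close> by (simp add: field_simps)
      finally show ?thesis .
    qed
    then show "\<exists>d>0. \<forall>n y. y \<in> {-T..T} \<and> norm (x - y) < d \<longrightarrow> norm (U n x - U n y) < e"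
      using \<open>0 < e\<close> \<open>R > 0\<close> by (intro exI[of _ "e / R"]) auto
  next
    show "norm (U n x) \<le> \<rho>\<^sub>0" if "x \<in> {-T..T}" for n x by (rule U_bound[OF that])
  next
    fix u \<kappa> assume "continuous_on {-T..T} u" "strict_mono (\<kappa> :: nat \<Rightarrow> nat)"
      "\<And>e. 0 < e \<Longrightarrow> \<exists>N. \<forall>n x. n \<ge> N \<and> x \<in> {-T..T} \<longrightarrow> norm (U (\<kappa> n) x - u x) < e"
    from that[OF this] show thesis .
  qed simp
  \<comment> \<open>The momenta of the first cells are so far only bounded; a second subsequence
    makes them converge and fixes the integration constant \<open>c\<close>.\<close>
  have "bounded (range (\<lambda>n. g (sl (\<kappa> n) 0)))"
    using slb(1) by (auto simp: bounded_iff)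
  then obtain c \<tau> where "strict_mono \<tau>" and c: "((\<lambda>n. g (sl (\<kappa> n) 0)) \<circ> \<tau>) \<longlonglongrightarrow> c"
    using bounded_imp_convergent_subsequence by blast
  define \<sigma> where "\<sigma> = \<kappa> \<circ> \<tau>"
  have \<sigma>: "strict_mono \<sigma>" unfolding \<sigma>_def using \<open>strict_mono \<kappa>\<close> \<open>strict_mono \<tau>\<close> by (rule strict_mono_o)
  have c: "(\<lambda>n. g (sl (\<sigma> n) 0)) \<longlonglongrightarrow> c" using c by (simp add: \<sigma>_def o_def)
  have h_lim: "(\<lambda>n. h (\<sigma> n)) \<longlonglongrightarrow> 0" using LIMSEQ_subseq_LIMSEQ[OF h_lim \<sigma>] by (simp add: o_def)
  have U_lim: "(\<lambda>n. U (\<sigma> n) t) \<longlonglongrightarrow> u t" if t: "t \<in> {-T..T}" for t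
  proof -
    have "(\<lambda>n. U (\<kappa> n) t) \<longlonglongrightarrow> u t"
      using unif t by (intro LIMSEQ_I) blast
    from LIMSEQ_subseq_LIMSEQ[OF this \<open>strict_mono \<tau>\<close>] show ?thesis by (simp add: \<sigma>_def o_def)
  qed
  have u_Lip: "norm (u t - u s) \<le> R * \<bar>t - s\<bar>" if "s \<in> {-T..T}" "t \<in> {-T..T}" for s t
    by (rule Lim_norm_ubound[OF trivial_limit_sequentially tendsto_diff[OF U_lim[OF that(2)] U_lim[OF that(1)]]])
       (intro always_eventually allI U_Lip that)
  have u_per: "u (-T) = u T"
    using LIMSEQ_unique[OF U_lim[of "-T"], of "u T"] U_lim[of T] T_pos by (simp add: U_per)

  \<comment> \<open>Convergence of forces and momenta\<close>
  define W where "W = (\<lambda>t. V\<^sub>x t (u t) + f t)"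
  have w_lim: "(\<lambda>n. w (\<sigma> n) t) \<longlonglongrightarrow> W t" if t: "t \<in> {-T..T}" for t
  proof -
    have "(\<lambda>n. R * h (\<sigma> n)) \<longlonglongrightarrow> 0" using tendsto_mult_right_zero[OF h_lim] .
    then have "(\<lambda>n. X (\<sigma> n) (cl (\<sigma> n) t) - U (\<sigma> n) t) \<longlonglongrightarrow> 0"
      by (rule Lim_null_comparison[rotated]) (intro always_eventually allI XU t)
    from tendsto_add[OF this U_lim[OF t]] have "(\<lambda>n. X (\<sigma> n) (cl (\<sigma> n) t)) \<longlonglongrightarrow> u t" by simp
    moreover have "isCont (V\<^sub>x t) (u t)"
    proof -
      have "continuous_on UNIV (\<lambda>x. (\<lambda>(t, x). V\<^sub>x t x) (t, x))"
        by (rule continuous_on_compose2[OF Vx_cont]) (use t in \<open>auto intro!: continuous_intros\<close>)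
      then show ?thesis by (simp add: continuous_on_eq_continuous_at)
    qed
    ultimately have "(\<lambda>n. V\<^sub>x t (X (\<sigma> n) (cl (\<sigma> n) t))) \<longlonglongrightarrow> V\<^sub>x t (u t)" by (rule isCont_tendsto_compose[rotated])
    then show ?thesis unfolding w_def W_def by (intro tendsto_add tendsto_const)
  qed
  have W_lim: "(\<lambda>n. integral {-T..t} (w (\<sigma> n))) \<longlonglongrightarrow> integral {-T..t} W" if t: "t \<in> {-T..T}" for t
    by (rule dominated_convergence(2)[where h = "\<lambda>t. M + norm (f t)"])
       (use t w_int norm_f_integrable w_bound w_lim in auto)
  define q where "q = (\<lambda>t. c + integral {-T..t} W)"
  have q_cont: "continuous_on {-T..T} q"
    unfolding q_def W_def
    by (intro continuous_intros indefinite_integral_continuous_1 force_integrable u_cont) simp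
  have P_lim: "(\<lambda>n. P (\<sigma> n) t) \<longlonglongrightarrow> q t" if t: "t \<in> {-T..T}" for t
  proof -
    \<comment> \<open>Integrals over the vanishing intervals \<open>{s..a n}\<close> tend to zero
      although the integrand changes with \<open>n\<close>, because \<open>\<Theta>\<close> controls
      them all.\<close>
    have A: "(\<lambda>n. integral {-T..a n} (w (\<sigma> n)) - integral {-T..s} (w (\<sigma> n))) \<longlonglongrightarrow> 0"
      if s: "s \<in> {-T..T}" and a: "\<And>n. s \<le> a n" "\<And>n. a n \<le> T" "\<And>n. a n \<le> s + h (\<sigma> n)" for s a
    proof (rule Lim_null_comparison)
      show "eventually (\<lambda>n. norm (integral {-T..a n} (w (\<sigma> n)) - integral {-T..s} (w (\<sigma> n))) \<le> \<Theta> (a n) - \<Theta> s) sequentially"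
        using s a by (intro always_eventually allI w_diff) auto
      have "(\<lambda>n. s + h (\<sigma> n)) \<longlonglongrightarrow> s + 0" by (intro tendsto_intros h_lim)
      then have "a \<longlonglongrightarrow> s"
        by (intro tendsto_sandwich[of "\<lambda>_. s" a sequentially "\<lambda>n. s + h (\<sigma> n)"] always_eventually allI a tendsto_const) simp
      then have "(\<lambda>n. \<Theta> (a n)) \<longlonglongrightarrow> \<Theta> s"
        by (rule continuous_on_tendsto_compose[OF \<Theta>_cont]) (use s a in \<open>auto intro!: always_eventually intro: order_trans\<close>)
      from tendsto_diff[OF this tendsto_const[of "\<Theta> s"]] show "(\<lambda>n. \<Theta> (a n) - \<Theta> s) \<longlonglongrightarrow> 0" by simp
    qed
    have h0: "h k > 0" for k by (rule grid.h_pos[OF grid])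
    have 1: "(\<lambda>n. integral {-T..nd (\<sigma> n) (Suc (cl (\<sigma> n) t))} (w (\<sigma> n)) - integral {-T..t} (w (\<sigma> n))) \<longlonglongrightarrow> 0"
    proof (rule A[OF t])
      fix n
      show "t \<le> nd (\<sigma> n) (Suc (cl (\<sigma> n) t))" by (rule cb(2)[OF t])
      show "nd (\<sigma> n) (Suc (cl (\<sigma> n) t)) \<le> t + h (\<sigma> n)" using cb(1)[OF t, of "\<sigma> n"] by (simp add: ndS)
      show "nd (\<sigma> n) (Suc (cl (\<sigma> n) t)) \<le> T" using ndb[of "Suc (cl (\<sigma> n) t)" "\<sigma> n"] cll[of "\<sigma> n" t] by simp
    qed
    have 2: "(\<lambda>n. integral {-T..nd (\<sigma> n) 1} (w (\<sigma> n)) - integral {-T..-T} (w (\<sigma> n))) \<longlonglongrightarrow> 0"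
    proof (rule A)
      fix n
      show "nd (\<sigma> n) 1 \<le> T" using ndb[of 1 "\<sigma> n"] by simp
    qed (use T_pos h0 nd0 ndS[of _ 0] in \<open>auto simp: less_imp_le\<close>)
    have "(\<lambda>n. g (sl (\<sigma> n) 0) + ((integral {-T..nd (\<sigma> n) (Suc (cl (\<sigma> n) t))} (w (\<sigma> n)) - integral {-T..t} (w (\<sigma> n)))
        + integral {-T..t} (w (\<sigma> n)) - (integral {-T..nd (\<sigma> n) 1} (w (\<sigma> n)) - integral {-T..-T} (w (\<sigma> n)))))
        \<longlonglongrightarrow> c + (0 + integral {-T..t} W - 0)"
      by (intro tendsto_add tendsto_diff c 1 2 W_lim t)
    then show ?thesis unfolding P_eq q_def by simp
  qed

  \<comment> \<open>Identification of the limit momentum\<close>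
  have main: "g D = q s" if s: "s \<in> {-T<..<T}" and D: "(u has_vector_derivative D) (at s)" for s D
  proof (rule Minty)
    fix z
    define l where "l = q s - g z"
    \<comment> \<open>Bounds the distance of all slopes from \<open>z\<close>, the factor in the
      error made when the momentum is replaced by \<open>q s\<close>.\<close>
    define K where "K = R + norm z"
    have K: "K > 0" using \<open>R > 0\<close> by (simp add: K_def add_pos_nonneg)
    \<comment> \<open>Monotonicity is integrated over \<open>{s..t}\<close>: the slopes then enter
      through increments of \<open>U\<close>, which converge, and the momenta through the distance
      of \<open>P\<close> from \<open>q s\<close>, whose integral converges by domination.\<close>
    have ineq: "0 \<le> l \<bullet> (u t - u s - (t - s) *\<^sub>R z) + K * integral {s..t} (\<lambda>\<tau>. norm (q \<tau> - q s))"
      if t: "s \<le> t" "t \<le> T" for t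
    proof (rule tendsto_lowerbound)
      let ?J = "\<lambda>n. l \<bullet> (U (\<sigma> n) t - U (\<sigma> n) s - (t - s) *\<^sub>R z) + K * integral {s..t} (\<lambda>\<tau>. norm (P (\<sigma> n) \<tau> - q s))"
      have Pint: "(\<lambda>\<tau>. norm (P k \<tau> - q s)) integrable_on {s..t}" for k
        unfolding P_def cl_def using grid.step_integrable[OF grid, of s t "\<lambda>j. norm (g (sl k j) - q s)" k] s t by simp
      have "(\<lambda>n. integral {s..t} (\<lambda>\<tau>. norm (P (\<sigma> n) \<tau> - q s))) \<longlonglongrightarrow> integral {s..t} (\<lambda>\<tau>. norm (q \<tau> - q s))"
      proof (rule dominated_convergence(2)[where h = "\<lambda>_. B + norm (q s)"])
        show "norm (norm (P (\<sigma> n) \<tau> - q s)) \<le> B + norm (q s)" for n \<tau>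
          using norm_triangle_ineq4[of "P (\<sigma> n) \<tau>" "q s"] P_bound[of "\<sigma> n" \<tau>] by simp
        show "(\<lambda>n. norm (P (\<sigma> n) \<tau> - q s)) \<longlonglongrightarrow> norm (q \<tau> - q s)" if "\<tau> \<in> {s..t}" for \<tau>
          using that s t by (intro tendsto_intros P_lim) auto
      qed (use Pint in auto)
      then show "?J \<longlonglongrightarrow> l \<bullet> (u t - u s - (t - s) *\<^sub>R z) + K * integral {s..t} (\<lambda>\<tau>. norm (q \<tau> - q s))"
        using s t by (intro tendsto_intros U_lim) auto
      have "0 \<le> ?J n" for n
      proof -
        let ?v = "\<lambda>\<tau>. sl (\<sigma> n) (cl (\<sigma> n) \<tau>)"
        have vi: "?v integrable_on {s..t}"
          unfolding cl_def using grid.step_integrable[OF grid, of s t "sl (\<sigma> n)"] s t by simp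
        have vz: "((\<lambda>\<tau>. ?v \<tau> - z) has_integral (U (\<sigma> n) t - U (\<sigma> n) s - (t - s) *\<^sub>R z)) {s..t}"
          using has_integral_diff[OF integrable_integral[OF vi] has_integral_const_real[of z s t]]
            U_diff[of s t "\<sigma> n"] s t by simp
        have "((\<lambda>\<tau>. l \<bullet> (?v \<tau> - z) + K * norm (P (\<sigma> n) \<tau> - q s)) has_integral ?J n) {s..t}"
          by (intro has_integral_add has_integral_mult_right integrable_integral Pint
              has_integral_linear[OF vz bounded_linear_inner_right, unfolded o_def])
        moreover have "0 \<le> l \<bullet> (?v \<tau> - z) + K * norm (P (\<sigma> n) \<tau> - q s)" for \<tau>
        proof -
          have "0 \<le> (P (\<sigma> n) \<tau> - g z) \<bullet> (?v \<tau> - z)" unfolding P_def by (rule g_monotone)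
          also have "\<dots> = l \<bullet> (?v \<tau> - z) + (P (\<sigma> n) \<tau> - q s) \<bullet> (?v \<tau> - z)"
            by (simp add: l_def inner_diff_left)
          also have "(P (\<sigma> n) \<tau> - q s) \<bullet> (?v \<tau> - z) \<le> norm (P (\<sigma> n) \<tau> - q s) * norm (?v \<tau> - z)"
            by (rule norm_cauchy_schwarz)
          also have "\<dots> \<le> norm (P (\<sigma> n) \<tau> - q s) * K"
            using norm_triangle_ineq4[of "?v \<tau>" z] v_bound[of "\<sigma> n" \<tau>]
            by (intro mult_left_mono) (auto simp: K_def)
          finally show ?thesis by (simp add: mult.commute)
        qed
        ultimately show ?thesis by (rule has_integral_nonneg)
      qed
      then show "eventually (\<lambda>n. 0 \<le> ?J n) sequentially" by (intro always_eventually allI)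
    qed simp
    \<comment> \<open>Divide by \<open>t - s\<close> and let \<open>t\<close> decrease to
      \<open>s\<close>: continuity of \<open>q\<close> keeps the error at most
      \<open>\<epsilon>\<close>, and the difference quotient tends to
      \<open>l \<bullet> D\<close>.\<close>
    have "0 \<le> l \<bullet> D - l \<bullet> z + \<epsilon>" if "\<epsilon> > 0" for \<epsilon>
    proof -
      define e where "e = \<epsilon> / K"
      have e: "e > 0" "K * e = \<epsilon>" using that K by (auto simp: e_def)
      obtain \<delta> where \<delta>: "\<delta> > 0" "\<And>\<tau>. \<tau> \<in> {-T..T} \<Longrightarrow> dist \<tau> s < \<delta> \<Longrightarrow> dist (q \<tau>) (q s) < e"
        using q_cont s e(1) unfolding continuous_on_iff by (metis greaterThanLessThan_subseteq_atLeastAtMost_iff order_refl subsetD)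
      have quot: "l \<bullet> z - \<epsilon> \<le> (l \<bullet> u t - l \<bullet> u s) / (t - s)" if t: "s < t" "t < s + \<delta>" "t < T" for t
      proof -
        have "integral {s..t} (\<lambda>\<tau>. norm (q \<tau> - q s)) \<le> integral {s..t} (\<lambda>\<tau>. e)"
        proof (rule integral_le)
          have "continuous_on {s..t} (\<lambda>\<tau>. norm (q \<tau> - q s))"
            by (intro continuous_intros continuous_on_subset[OF q_cont]) (use s t in auto)
          then show "(\<lambda>\<tau>. norm (q \<tau> - q s)) integrable_on {s..t}" by (rule integrable_continuous_real)
          show "norm (q \<tau> - q s) \<le> e" if "\<tau> \<in> {s..t}" for \<tau>
            using \<delta>(2)[of \<tau>] that s t by (auto simp: dist_norm)
        qed (rule integrable_const_ivl)
        then have "K * integral {s..t} (\<lambda>\<tau>. norm (q \<tau> - q s)) \<le> K * ((t - s) * e)"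
          using K t by (intro mult_left_mono) auto
        also have "\<dots> = (t - s) * \<epsilon>" by (simp flip: e(2))
        finally have "0 \<le> l \<bullet> (u t - u s - (t - s) *\<^sub>R z) + (t - s) * \<epsilon>"
          using ineq[of t] t by simp
        then have "(l \<bullet> z - \<epsilon>) * (t - s) \<le> l \<bullet> u t - l \<bullet> u s"
          by (simp add: inner_diff_right algebra_simps)
        then show ?thesis using t by (simp add: pos_le_divide_eq)
      qed
      have "((\<lambda>t. l \<bullet> u t) has_real_derivative l \<bullet> D) (at s)"
        using bounded_linear.has_vector_derivative[OF bounded_linear_inner_right D, of l]
        by (simp add: has_real_derivative_iff_has_vector_derivative)
      then have "((\<lambda>t. (l \<bullet> u t - l \<bullet> u s) / (t - s)) \<longlongrightarrow> l \<bullet> D) (at_right s)"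
        unfolding has_field_derivative_iff by (rule tendsto_within_subset) simp
      moreover have "eventually (\<lambda>t. l \<bullet> z - \<epsilon> \<le> (l \<bullet> u t - l \<bullet> u s) / (t - s)) (at_right s)"
        unfolding eventually_at_right_field using quot s \<delta>(1)
        by (intro exI[of _ "min (s + \<delta>) T"]) auto
      ultimately have "l \<bullet> z - \<epsilon> \<le> l \<bullet> D" by (rule tendsto_lowerbound) simp
      then show ?thesis by simp
    qed
    then have "0 \<le> l \<bullet> D - l \<bullet> z" by (rule field_le_epsilon)
    then show "0 \<le> (q s - g z) \<bullet> (D - z)" by (simp add: l_def inner_diff_right)
  qed
  show thesis
  proof (rule that)
    show "norm (u t - u s) \<le> R * \<bar>t - s\<bar>" if "s \<in> {-T..T}" "t \<in> {-T..T}" for s t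
      by (rule u_Lip[OF that])
    show "u (-T) = u T" by (rule u_per)
    show "g D = c + integral {-T..s} (\<lambda>t. V\<^sub>x t (u t) + f t)"
      if "s \<in> {-T<..<T}" "(u has_vector_derivative D) (at s)" for s D
      using main[OF that] by (simp add: q_def W_def)
  qed
qed

end

section \<open>Existence of periodic solutions\<close>

lemma ac_derivative_cong:
  assumes "ac_derivative T P Q" "\<And>t. t \<in> {-T..T} \<Longrightarrow> P' t = P t" "\<And>t. t \<in> {-T..T} \<Longrightarrow> Q' t = Q t"
  shows "ac_derivative T P' Q'"
proof -
  obtain w where w: "abs_continuous_on (- T) T w" "AE t in lebesgue_on {-T..T}. P t = w t"
    "AE t in lebesgue_on {-T..T}. (w has_vector_derivative Q t) (at t)"
    using assms(1) unfolding ac_derivative_def by blast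
  have "AE t in lebesgue_on {-T..T}. P' t = w t"
    using w(2) AE_space by eventually_elim (simp add: assms(2))
  moreover have "AE t in lebesgue_on {-T..T}. (w has_vector_derivative Q' t) (at t)"
    using w(3) AE_space by eventually_elim (simp add: assms(3))
  ultimately show ?thesis using w(1) unfolding ac_derivative_def by blast
qed

context action
begin

text \<open>Being Lipschitz, \<open>u\<close> is a primitive and hence differentiable almost
  everywhere, and the integrated equation exhibits \<open>q\<close> as the absolutely continuous
  representative of \<open>g (dot u)\<close>. Boundedness of \<open>q\<close> bounds
  \<open>dot u\<close> through coercivity, which gives membership of \<open>dot u\<close> in the
  Orlicz space.\<close>

lemma periodic_solution_exists:
  obtains u where "u \<in> orlicz_sobolev T G"
    "ac_derivative T (\<lambda>t. g (dot u t)) (\<lambda>t. V\<^sub>x t (u t) + f t)"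
proof -
  obtain u c R where
    u_Lip: "\<And>s t. s \<in> {-T..T} \<Longrightarrow> t \<in> {-T..T} \<Longrightarrow> norm (u t - u s) \<le> R * \<bar>t - s\<bar>" and per: "u (-T) = u T"
    and EL: "\<And>s D. s \<in> {-T<..<T} \<Longrightarrow> (u has_vector_derivative D) (at s) \<Longrightarrow>
      g D = c + integral {-T..s} (\<lambda>t. V\<^sub>x t (u t) + f t)"
    by (rule Euler_Lagrange_solution) blast
  let ?M = "lebesgue_on {-T..T}"
  obtain v where v: "v absolutely_integrable_on {-T..T}"
    "\<And>t. t \<in> {-T..T} \<Longrightarrow> u t = u (-T) + integral {-T..t} v"
    using Lipschitz_has_vector_density[of "-T" T u R] u_Lip T_pos by auto
  have ac: "abs_continuous_on (-T) T u" by (rule primitive_abs_continuous_on[OF v])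
  then have cont: "continuous_on {-T..T} u" by (rule abs_continuous_on_imp_continuous_on)
  have um: "u \<in> borel_measurable ?M"
    by (rule continuous_imp_measurable_on_sets_lebesgue[OF cont]) simp
  have dm: "dot u \<in> borel_measurable ?M" by (rule primitive_dot_measurable[OF v])
  define w where "w = (\<lambda>t. V\<^sub>x t (u t) + f t)"
  define q where "q = (\<lambda>t. c + integral {-T..t} w)"
  have wa: "w absolutely_integrable_on {-T..T}"
    unfolding w_def
    by (intro set_integral_add f absolutely_integrable_continuous_real Vx_continuous cont)
  have q_ac: "abs_continuous_on (-T) T q" and q_der: "AE t in ?M. (q has_vector_derivative w t) (at t)"
    using primitive_abs_continuous_on[OF wa, of q c] primitive_AE_has_vector_derivative[OF wa, of q c]
    by (auto simp: q_def)
  have "AE t in ?M. t \<in> {-T<..<T}"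
    unfolding AE_lebesgue_on_iff_negligible
    by (rule negligible_subset[of "{-T, T}"]) auto
  moreover have "AE t in ?M. (u has_vector_derivative v t) (at t)"
    by (rule primitive_AE_has_vector_derivative[OF v])
  ultimately have EL': "AE t in ?M. g (dot u t) = q t"
    by eventually_elim (simp add: EL q_def w_def vector_derivative_at)
  have "bounded (q ` {-T..T})"
    using abs_continuous_on_imp_continuous_on[OF q_ac] by (intro compact_imp_bounded compact_continuous_image) auto
  then obtain B where B: "\<And>t. t \<in> {-T..T} \<Longrightarrow> norm (q t) \<le> B" unfolding bounded_iff by blast
  obtain R' where R': "\<And>y. norm (g y) \<le> B \<Longrightarrow> norm y \<le> R'" by (rule g_coercive[of B]) blast
  have fin: "(\<integral>\<^sup>+t. ennreal (G (y t)) \<partial>?M) < \<infinity>"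
    if "AE t in ?M. norm (y t) \<le> S" for y S
  proof -
    have "bounded (G ` cball 0 S)"
      by (intro compact_imp_bounded compact_continuous_image continuous_on_subset[OF G_function_continuous[OF G]]) auto
    then obtain b where "\<forall>z\<in>G ` cball 0 S. norm z \<le> b" unfolding bounded_iff by blast
    then have b: "\<bar>G z\<bar> \<le> b" if "norm z \<le> S" for z using that by simp
    have "AE t in ?M. ennreal (G (y t)) \<le> ennreal b"
      using that
    proof eventually_elim
      case (elim t)
      show ?case by (intro ennreal_leI order_trans[OF abs_ge_self b[OF elim]])
    qed
    then have "(\<integral>\<^sup>+t. ennreal (G (y t)) \<partial>?M) \<le> (\<integral>\<^sup>+t. ennreal b \<partial>?M)" by (rule nn_integral_mono_AE)
    also have "\<dots> < \<infinity>" using T_pos by (simp add: emeasure_restrict_space ennreal_mult_less_top)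
    finally show ?thesis .
  qed
  have "bounded (u ` {-T..T})"
    using cont by (intro compact_imp_bounded compact_continuous_image) auto
  then obtain S where "\<And>t. t \<in> {-T..T} \<Longrightarrow> norm (u t) \<le> S" unfolding bounded_iff by blast
  then have "AE t in ?M. norm (u t) \<le> S" by (intro AE_I2) simp
  then have "u \<in> orlicz T G" using um fin by (simp add: orlicz_def)
  moreover have "AE t in ?M. norm (dot u t) \<le> R'"
    using EL' AE_space by eventually_elim (simp add: R' B)
  then have "dot u \<in> orlicz T G" using dm fin by (simp add: orlicz_def)
  ultimately have "u \<in> orlicz_sobolev T G" using ac per by (simp add: orlicz_sobolev_def)
  moreover have "ac_derivative T (\<lambda>t. g (dot u t)) (\<lambda>t. V\<^sub>x t (u t) + f t)"
    unfolding ac_derivative_def using q_ac EL' q_der by (auto simp: w_def)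
  ultimately show thesis by (rule that)
qed

end

section \<open>Gradients of continuously differentiable functions\<close>

lemma blinfun_eq_inner_sum_Basis:
  fixes l :: "'a::euclidean_space \<Rightarrow>\<^sub>L real"
  shows "blinfun_apply l = (\<lambda>h. h \<bullet> (\<Sum>b\<in>Basis. blinfun_apply l b *\<^sub>R b))"
proof
  fix h
  have "blinfun_apply l h = blinfun_apply l (\<Sum>b\<in>Basis. (h \<bullet> b) *\<^sub>R b)" by (simp add: euclidean_representation)
  also have "\<dots> = h \<bullet> (\<Sum>b\<in>Basis. blinfun_apply l b *\<^sub>R b)"
    by (simp add: blinfun.sum_right blinfun.scaleR_right inner_sum_right mult.commute)
  finally show "blinfun_apply l h = h \<bullet> (\<Sum>b\<in>Basis. blinfun_apply l b *\<^sub>R b)" .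
qed

lemma C1_on_UNIV_gradient:
  fixes G :: "'a::euclidean_space \<Rightarrow> real"
  assumes "C1_on UNIV G"
  obtains g where "\<And>x. GDERIV G x :> g x" "continuous_on UNIV g"
proof -
  obtain G' where G': "\<And>z. (G has_derivative blinfun_apply (G' z)) (at z)" "continuous_on UNIV G'"
    using assms by (auto simp: C1_on_def)
  show thesis
  proof
    show "GDERIV G x :> (\<Sum>b\<in>Basis. blinfun_apply (G' x) b *\<^sub>R b)" for x
      using G'(1)[of x] unfolding gderiv_def by (subst (asm) blinfun_eq_inner_sum_Basis)
    show "continuous_on UNIV (\<lambda>x. \<Sum>b\<in>Basis. blinfun_apply (G' x) b *\<^sub>R b)"
      by (intro continuous_intros G'(2))
  qed
qed

text \<open>Restricted to the slice through \<open>t\<close>, the derivative within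
  \<open>S \<times> UNIV\<close> becomes a full derivative in \<open>x\<close>, also when
  \<open>t\<close> is a boundary point of \<open>S\<close>.\<close>

lemma C1_on_Times_partial_gradient:
  fixes F :: "'s::real_normed_vector \<Rightarrow> 'a::euclidean_space \<Rightarrow> real"
  assumes "C1_on (S \<times> UNIV) (\<lambda>(t, x). F t x)"
  obtains F\<^sub>x where "\<And>t x. t \<in> S \<Longrightarrow> GDERIV (F t) x :> F\<^sub>x t x"
    "continuous_on (S \<times> UNIV) (\<lambda>(t, x). F t x)" "continuous_on (S \<times> UNIV) (\<lambda>(t, x). F\<^sub>x t x)"
proof -
  obtain F' where F': "\<And>z. z \<in> S \<times> UNIV \<Longrightarrow> ((\<lambda>(t, x). F t x) has_derivative blinfun_apply (F' z)) (at z within S \<times> UNIV)"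
    "continuous_on (S \<times> UNIV) F'"
    using assms by (auto simp: C1_on_def)
  define F\<^sub>x where "F\<^sub>x = (\<lambda>t x. \<Sum>b\<in>Basis. blinfun_apply (F' (t, x)) (0, b) *\<^sub>R b)"
  show thesis
  proof
    fix t and x :: 'a assume t: "t \<in> S"
    have 1: "((\<lambda>y. (t, y)) has_derivative (\<lambda>h. (0, h))) (at x)"
      by (intro derivative_intros)
    have "((\<lambda>(t, x). F t x) has_derivative blinfun_apply (F' (t, x))) (at (t, x) within (\<lambda>y. (t, y)) ` UNIV)"
      by (rule has_derivative_subset[OF F'(1)]) (use t in auto)
    from has_derivative_in_compose[OF 1 this]
    have 2: "((\<lambda>y. F t y) has_derivative (\<lambda>h. blinfun_apply (F' (t, x)) (0, h))) (at x)" by simp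
    have "blinfun_apply (F' (t, x)) (0, h) = h \<bullet> F\<^sub>x t x" for h
    proof -
      have bl: "bounded_linear (\<lambda>h. blinfun_apply (F' (t, x)) (0, h))"
        using 2 by (rule has_derivative_bounded_linear)
      show ?thesis
        using fun_cong[OF blinfun_eq_inner_sum_Basis[of "Blinfun (\<lambda>h. blinfun_apply (F' (t, x)) (0, h))"], of h] bl
        by (simp add: bounded_linear_Blinfun_apply F\<^sub>x_def)
    qed
    then show "GDERIV (F t) x :> F\<^sub>x t x" using 2 by (simp add: gderiv_def)
  next
    show "continuous_on (S \<times> UNIV) (\<lambda>(t, x). F t x)"
      using F'(1) by (rule has_derivative_continuous_on)
    show "continuous_on (S \<times> UNIV) (\<lambda>(t, x). F\<^sub>x t x)"
      unfolding F\<^sub>x_def split_def by (intro continuous_intros) (simp add: F'(2))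
  qed
qed

theorem theorem1p2:
  fixes T :: real
    and L :: "real \<Rightarrow> real ^ 'n \<Rightarrow> real ^ 'n \<Rightarrow> real"
    and G :: "real ^ 'n \<Rightarrow> real"
    and V K W :: "real \<Rightarrow> real ^ 'n \<Rightarrow> real"
    and f :: "real \<Rightarrow> real ^ 'n"
    and a \<kappa> :: "real \<Rightarrow> real"
    and b b\<^sub>1 p \<rho>\<^sub>0 \<rho> \<nu> \<mu> C :: real
  assumes T: "T > 0"
    and L: "\<And>t x v. t \<in> {-T..T} \<Longrightarrow> L t x v = G v + V t x + f t \<bullet> x"
    and A1: "G_function G" "C1_on UNIV G" "delta2 G" "nabla2 G"
    and A2: "\<And>t x. t \<in> {-T..T} \<Longrightarrow> V t x = K t x - W t x"
            "C1_on ({-T..T} \<times> UNIV) (\<lambda>(t, x). K t x)"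
            "C1_on ({-T..T} \<times> UNIV) (\<lambda>(t, x). W t x)"
    and A3: "integrable (lebesgue_on {-T..T}) a" "b > 1" "\<rho>\<^sub>0 > 0"
            "\<And>t x. t \<in> {-T..T} \<Longrightarrow> norm x \<le> \<rho>\<^sub>0 \<Longrightarrow> V t x \<ge> b * G x - a t"
    and A4: "b\<^sub>1 > 0" "p > 1" "(\<lambda>x. norm x powr p) \<prec>\<^sub>G G"
            "\<forall>\<epsilon>>0. \<exists>r>0. \<forall>x. \<forall>t\<in>{-T..T}. norm x > r \<longrightarrow> K t x \<ge> (b\<^sub>1 - \<epsilon>) * norm x powr p"
            "\<exists>\<epsilon>\<^sub>0>0. \<exists>r>0. \<forall>x. \<forall>t\<in>{-T..T}. norm x > r \<longrightarrow> W t x \<ge> (3 + \<epsilon>\<^sub>0) * max (K t x) (G x)"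
    and A5: "\<mu> > q_infty G + \<nu>"
            "integrable (lebesgue_on {-T..T}) \<kappa>" "\<And>t. t \<in> {-T..T} \<Longrightarrow> \<kappa> t \<ge> 0"
            "\<And>t x. t \<in> {-T..T} \<Longrightarrow>
               gradient (V t) x \<bullet> x \<le> (q_infty G + \<nu>) * K t x - \<mu> * W t x + \<kappa> t"
    and A6: "(\<integral>t. V t 0 \<partial>lebesgue_on {-T..T}) = 0"
    and A7: "f \<in> orlicz T (fenchel_conj G)"
    and C: "embedding_constant T G C"
    and \<rho>: "\<rho> = \<rho>\<^sub>0 / C" "\<rho> \<ge> 2"
    and small: "modular T (fenchel_conj G) f + (\<integral>t. a t \<partial>lebesgue_on {-T..T}) < min 1 (b - 1) * (\<rho> / 2)"
  shows "\<exists>u. periodic_solution T G V f u \<and> euler_lagrange T L u"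
proof -
  obtain g where g: "\<And>x. GDERIV G x :> g x" "continuous_on UNIV g"
    using C1_on_UNIV_gradient[OF A1(2)] by blast
  obtain K\<^sub>x where K\<^sub>x: "\<And>t x. t \<in> {-T..T} \<Longrightarrow> GDERIV (K t) x :> K\<^sub>x t x"
    "continuous_on ({-T..T} \<times> UNIV) (\<lambda>(t, x). K t x)" "continuous_on ({-T..T} \<times> UNIV) (\<lambda>(t, x). K\<^sub>x t x)"
    using C1_on_Times_partial_gradient[OF A2(2)] by blast
  obtain W\<^sub>x where W\<^sub>x: "\<And>t x. t \<in> {-T..T} \<Longrightarrow> GDERIV (W t) x :> W\<^sub>x t x"
    "continuous_on ({-T..T} \<times> UNIV) (\<lambda>(t, x). W t x)" "continuous_on ({-T..T} \<times> UNIV) (\<lambda>(t, x). W\<^sub>x t x)"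
    using C1_on_Times_partial_gradient[OF A2(3)] by blast
  define V\<^sub>x where "V\<^sub>x = (\<lambda>t x. K\<^sub>x t x - W\<^sub>x t x)"
  \<comment> \<open>By Fenchel-Young the forcing costs one copy of \<open>G x\<close> and the amount
    \<open>fenchel_conj G (f t)\<close>, which is independent of \<open>x\<close> and is added to
    \<open>a\<close> here.\<close>
  define \<alpha> where "\<alpha> = (\<lambda>t. a t + fenchel_conj G (f t))"
  have V_grad: "GDERIV (V t) x :> V\<^sub>x t x" if "t \<in> {-T..T}" for t x
  proof -
    have "V t = (\<lambda>x. K t x - W t x)" using A2(1)[OF that] by blast
    then show ?thesis using GDERIV_diff[OF K\<^sub>x(1)[OF that] W\<^sub>x(1)[OF that]] by (simp add: V\<^sub>x_def)
  qed
  have V_cont: "continuous_on ({-T..T} \<times> UNIV) (\<lambda>(t, x). V t x)"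
    using continuous_on_diff[OF K\<^sub>x(2) W\<^sub>x(2)]
    by (rule continuous_on_eq) (auto simp: A2(1))
  have Vx_cont: "continuous_on ({-T..T} \<times> UNIV) (\<lambda>(t, x). V\<^sub>x t x)"
    using continuous_on_diff[OF K\<^sub>x(3) W\<^sub>x(3)] by (simp add: V\<^sub>x_def split_def)
  have ai: "a absolutely_integrable_on {-T..T}" using A3(1) by (simp add: integrable_lebesgue_on_iff)
  note fi = orlicz_fenchel_conj_integrable[OF A1(1) A7]
  have C_pos: "C > 0" using C by (simp add: embedding_constant_def)
  have "action T \<rho>\<^sub>0 (\<rho> / 2) (b - 1) G g V V\<^sub>x \<alpha> f"
  proof
    show "\<alpha> integrable_on {-T..T}"
      unfolding \<alpha>_def using ai fi(1) by (intro integrable_add) (auto dest: set_lebesgue_integral_eq_integral(1))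
    show "(b - 1) * G x - \<alpha> t \<le> V t x + f t \<bullet> x" if "t \<in> {-T..T}" "norm x \<le> \<rho>\<^sub>0" for t x
    proof -
      \<comment> \<open>Evenness of \<open>G\<close> turns Fenchel-Young at \<open>- x\<close> into
        a lower bound for \<open>f t \<bullet> x\<close>.\<close>
      have "- (x \<bullet> f t) \<le> G x + fenchel_conj G (f t)"
        using fenchel_young[OF A1(1), of "- x" "f t"] A1(1) by (simp add: G_function_def)
      then show ?thesis using A3(4)[OF that] by (simp add: \<alpha>_def left_diff_distrib inner_commute)
    qed
    have "integral {-T..T} \<alpha> = integral {-T..T} a + integral {-T..T} (\<lambda>t. fenchel_conj G (f t))"
      unfolding \<alpha>_def using ai fi(1) by (intro integral_add) (auto dest: set_lebesgue_integral_eq_integral(1))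
    also have "\<dots> = (\<integral>t. a t \<partial>lebesgue_on {-T..T}) + modular T (fenchel_conj G) f"
      unfolding modular_def using A3(1) fi(1)
      by (simp add: lebesgue_integral_eq_integral integrable_lebesgue_on_iff)
    finally show "integral {-T..T} \<alpha> < min 1 (b - 1) * (\<rho> / 2)" using small by simp
    have "continuous_on {-T..T} (\<lambda>t. (\<lambda>(t, x). V t x) (t, 0))"
      by (rule continuous_on_compose2[OF V_cont]) (auto intro!: continuous_intros)
    then have "integrable (lebesgue_on {-T..T}) (\<lambda>t. V t 0)"
      by (intro continuous_imp_integrable_real) simp
    then show "integral {-T..T} (\<lambda>t. V t 0) = 0"
      using A6 by (simp add: lebesgue_integral_eq_integral)
    show "norm (u t) \<le> \<rho>\<^sub>0"
      if "u \<in> orlicz_sobolev T G" "modular T G u + modular T G (dot u) \<le> \<rho> / 2" "t \<in> {-T..T}" for u t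
    proof -
      \<comment> \<open>The assumption \<open>\<rho> \<ge> 2\<close> supplies
        \<open>\<rho> / 2 \<ge> 1\<close>, as required for comparing norms with modulars.\<close>
      have "norm (u t) \<le> C * (2 * (\<rho> / 2))"
        using \<rho>(2) by (intro embedding_constant_bound[OF A1(1) C T that(1,2) _ that(3)]) simp
      also have "\<dots> = \<rho>\<^sub>0" using \<rho>(1) C_pos by simp
      finally show ?thesis .
    qed
  qed (use T A1(1) g V_cont V_grad Vx_cont fi(2) A3 \<rho> in auto)
  then interpret action T \<rho>\<^sub>0 "\<rho> / 2" "b - 1" G g V V\<^sub>x \<alpha> f .
  obtain u where u: "u \<in> orlicz_sobolev T G" "ac_derivative T (\<lambda>t. g (dot u t)) (\<lambda>t. V\<^sub>x t (u t) + f t)"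
    by (rule periodic_solution_exists)
  have "periodic_solution T G V f u"
    unfolding periodic_solution_def
    using u(1) ac_derivative_cong[OF u(2)] by (simp add: gradient_eqI[OF g(1)] gradient_eqI[OF V_grad])
  moreover have "euler_lagrange T L u"
    unfolding euler_lagrange_def
  proof (rule ac_derivative_cong[OF u(2)])
    fix t assume t: "t \<in> {-T..T}"
    have "GDERIV (\<lambda>v. L t (u t) v) (dot u t) :> g (dot u t) + 0 + 0"
      unfolding L[OF t] by (intro GDERIV_add g(1) GDERIV_const)
    then show "gradient (\<lambda>v. L t (u t) v) (dot u t) = g (dot u t)" by (simp add: gradient_eqI)
    have "GDERIV (\<lambda>x. f t \<bullet> x) (u t) :> f t"
      unfolding gderiv_def by (auto intro!: derivative_eq_intros simp: inner_commute)
    then have "GDERIV (\<lambda>x. L t x (dot u t)) (u t) :> 0 + V\<^sub>x t (u t) + f t"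
      unfolding L[OF t] by (intro GDERIV_add V_grad[OF t] GDERIV_const)
    then show "gradient (\<lambda>x. L t x (dot u t)) (u t) = V\<^sub>x t (u t) + f t" by (simp add: gradient_eqI)
  qed
  ultimately show ?thesis by blast
qed

end
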